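(* Let $f\colon S^1\to\mathbb{R}$ be a function and let $C\in\mathbb{R}_{\ge 0}$. Then the following statements are equivalent: (i) $f$ is representable by a (non-negative, finite) Borel measure on $S^1$ with total mass $C$, i.e. there is a Borel measure $\nu$ on $S^1$ with $\nu(S^1)=C$ and $f(x)=\int_{S^1}d_{S^1}(x,y)\,\nu(\mathrm{d}y)$ for all $x\in S^1$. (ii) $f(x)+f(-x)=\pi\cdot C$ for all $x\in S^1$; $f$ is Lipschitz continuous and left-differentiable with $\partial_- f$ of finite total variation; and $\|\partial_- f\|_{\mathrm{TV}(S^1)}\le 4C$. Moreover, if $f$ is representable by a (non-negative, finite) Borel measure with total mass $C$, then there exists a unique (non-negative, finite) Borel measure $\mu$ on $S^1$ with $\mu(S^1)=\tfrac14\|\partial_- f\|_{\mathrm{TV}(S^1)}$ such that \[ \bar\mu=\mu+\Big[C-\tfrac14\,\|\partial_- f\|_{\mathrm{TV}(S^1)}\Big]\cdot\mathscr{H}^1 \] is a non-negative measure and $f$ is representable by $\bar\mu$, i.e. $f(x)=\int_{S^1}d_{S^1}(x,y)\,\bar\mu(\mathrm{d}y)$ for all $x\in S^1$.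
   Context: $S^1\subset\mathbb{R}^2$ is the unit circle with the spherical distance $d_{S^1}(x,y)=\arccos(\langle x,y\rangle)$ (the length of the shorter arc between $x$ and $y$). $\mathscr{H}^1$ denotes the normalized Hausdorff $1$-measure on $S^1$, so $\mathscr{H}^1(S^1)=1$. "Borel measure" means a finite non-negative Borel measure $\mu\colon\mathcal{B}(S^1)\to[0,\infty)$. Let $q\colon\mathbb{R}\to S^1$, $q(t)=(\cos t,\sin t)$, and for $x\in S^1$, $t\in\mathbb{R}$ set $x+_q t=q(a+t)$ for any $a\in q^{-1}(x)$. A function $f\colon S^1\to\mathbb{R}$ is left-differentiable if the limit $\partial_- f(x)=\lim_{t\to 0^-}\frac{f(x+_q t)-f(x)}{t}$ exists (in $\mathbb{R}$) for every $x\in S^1$. Lipschitz continuity is with respect to $d_{S^1}$. The total variation of a function $g\colon S^1\to\mathbb{R}$ is $\|g\|_{\mathrm{TV}(S^1)}=\sup\sum_{i=0}^{n}|g(x_i)-g(x_{i+1})|$, where the supremum is over all partitions $\{x_0,\dots,x_{n+1}\}$ of $S^1$, meaning $x_i=q(t_i)$ for some partition $0=t_0\le t_1\le\dots\le t_{n+1}=2\pi$ of $[0,2\pi]$. *)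

theory Defs
  imports "HOL-Analysis.Analysis"
begin

definition S1 :: "(real^2) set" where
  "S1 = sphere 0 1"

definition dS1 :: "real^2 \<Rightarrow> real^2 \<Rightarrow> real" where
  "dS1 x y = arccos (x \<bullet> y)"

definition q :: "real \<Rightarrow> real^2" where
  "q t = vector [cos t, sin t]"

(* The choice of the preimage does not matter, see circ_add_q. *)
definition circ_add :: "real^2 \<Rightarrow> real \<Rightarrow> real^2" where
  "circ_add x t = q ((SOME a. q a = x) + t)"

lemma circ_add_q: "circ_add (q a) t = q (a + t)"
proof -
  define b where "b = (SOME b. q b = q a)"
  have "q b = q a" unfolding b_def by (rule someI) (rule refl)
  then have "cos b = cos a" "sin b = sin a"
    unfolding q_def by (metis vector_2)+
  then have "q (b + t) = q (a + t)"
    by (simp add: q_def cos_add sin_add)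
  then show ?thesis by (simp add: circ_add_def b_def)
qed

lemma q_image: "range q = S1"
proof
  show "range q \<subseteq> S1"
    by (auto simp: q_def S1_def norm_eq_1 inner_vec_def sum_2 simp flip: power2_eq_square)
  show "S1 \<subseteq> range q"
  proof
    fix x assume "x \<in> S1"
    then have "(x$1)\<^sup>2 + (x$2)\<^sup>2 = 1"
      by (simp add: S1_def norm_eq_1 inner_vec_def sum_2 power2_eq_square)
    then obtain t where "x$1 = cos t" "x$2 = sin t"
      using sincos_total_2pi by metis
    then have "x = q t"
      by (simp add: q_def vec_eq_iff forall_2)
    then show "x \<in> range q" by blast
  qed
qed

text \<open>Functions on the circle are represented by functions on the whole plane;
  all notions below depend only on their values on \<^const>\<open>S1\<close>.\<close>

definition left_differentiable :: "(real^2 \<Rightarrow> real) \<Rightarrow> bool" where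
  "left_differentiable f \<longleftrightarrow>
     (\<forall>x\<in>S1. \<exists>l. ((\<lambda>t. (f (circ_add x t) - f x) / t) \<longlongrightarrow> l) (at_left 0))"

definition left_deriv :: "(real^2 \<Rightarrow> real) \<Rightarrow> real^2 \<Rightarrow> real" where
  "left_deriv f x = Lim (at_left 0) (\<lambda>t. (f (circ_add x t) - f x) / t)"

definition lipschitz_S1 :: "(real^2 \<Rightarrow> real) \<Rightarrow> bool" where
  "lipschitz_S1 f \<longleftrightarrow> (\<exists>L. \<forall>x\<in>S1. \<forall>y\<in>S1. \<bar>f x - f y\<bar> \<le> L * dS1 x y)"

definition tv_S1 :: "(real^2 \<Rightarrow> real) \<Rightarrow> ennreal" where
  "tv_S1 g =
     (SUP (n, t) \<in> {(n, t). t 0 = 0 \<and> t (Suc n) = 2 * pi \<and> (\<forall>i\<le>n. t i \<le> t (Suc i))}.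
        ennreal (\<Sum>i=0..n. \<bar>g (q (t i)) - g (q (t (Suc i)))\<bar>))"

definition finite_borel_S1 :: "(real^2) measure \<Rightarrow> bool" where
  "finite_borel_S1 \<nu> \<longleftrightarrow> sets \<nu> = sets (restrict_space borel S1) \<and> finite_measure \<nu>"

definition represents :: "(real^2) measure \<Rightarrow> (real^2 \<Rightarrow> real) \<Rightarrow> bool" where
  "represents \<nu> f \<longleftrightarrow> (\<forall>x\<in>S1. f x = (\<integral>y. dS1 x y \<partial>\<nu>))"

text \<open>Hausdorff 1-measure on the metric space (\<^const>\<open>S1\<close>, \<^const>\<open>dS1\<close>).\<close>

definition diam_S1 :: "(real^2) set \<Rightarrow> ennreal" where
  "diam_S1 U = (SUP x\<in>U. SUP y\<in>U. ennreal (dS1 x y))"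

definition hausdorff1_pre :: "real \<Rightarrow> (real^2) set \<Rightarrow> ennreal" where
  "hausdorff1_pre \<delta> A =
     (INF U \<in> {U :: nat \<Rightarrow> (real^2) set. (\<forall>i. U i \<subseteq> S1 \<and> diam_S1 (U i) \<le> ennreal \<delta>) \<and> A \<subseteq> (\<Union>i. U i)}.
        \<Sum>i. diam_S1 (U i))"

definition hausdorff1 :: "(real^2) set \<Rightarrow> ennreal" where
  "hausdorff1 A = (SUP \<delta>\<in>{0<..}. hausdorff1_pre \<delta> A)"

definition normalized_H1 :: "(real^2) measure" where
  "normalized_H1 =
     measure_of S1 (sets (restrict_space borel S1)) (\<lambda>A. hausdorff1 A / hausdorff1 S1)"

(* The measure \<mu>' is the set function \<mu> + c * normalized_H1.  As c may a priori be negative,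
   the existence of such a \<mu>' says that this signed measure is non-negative. *)
definition is_shift_by_H1 :: "(real^2) measure \<Rightarrow> (real^2) measure \<Rightarrow> real \<Rightarrow> bool" where
  "is_shift_by_H1 \<mu>' \<mu> c \<longleftrightarrow>
     finite_borel_S1 \<mu>' \<and>
     (\<forall>A\<in>sets (restrict_space borel S1). measure \<mu>' A = measure \<mu> A + c * measure normalized_H1 A)"

end

theory Submission
  imports Defs
begin

text \<open>
  Write \<open>\<nu>\<^sup>-\<close> for the image of a measure \<open>\<nu>\<close> under the antipodal map and
  \<open>f\<close> for the potential of \<open>\<nu>\<close>. As \<open>a\<close> increases, the distance from \<open>q a\<close> to a
  point of the half circle behind it grows at unit speed, and the distance to a point of the half
  circle ahead of it shrinks at unit speed. By dominated convergence,
  \<^term>\<open>left_deriv f (q a)\<close> is therefore the mass behind \<open>q a\<close> minus the mass ahead of it, and moving from \<open>q a\<close> to \<open>q b\<close> changes it by twice \<open>\<nu> - \<nu>\<^sup>-\<close> of the arc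
  \<open>[a, b)\<close>. So \<open>f\<close> determines the odd part \<open>\<nu> - \<nu>\<^sup>-\<close>, and, as \<open>f x + f (- x)\<close> is
  \<open>\<pi>\<close> times the total mass of \<open>\<nu>\<close>, these two data determine \<open>f\<close>. Any measure \<open>\<kappa>\<close> with the same
  odd part as \<open>\<nu>\<close> satisfies \<open>\<parallel>\<partial>\<^sub>- f\<parallel> \<le> 4 \<kappa>(S\<^sup>1)\<close> (\<open>represents_tv_le\<close>), which for \<open>\<kappa> = \<nu>\<close> is the
  variation bound of the theorem.

  Conversely, a function \<open>h\<close> of finite variation with \<open>h (t + \<pi>) = - h t\<close> is a difference of two
  monotone functions that together increase by no more than the variation. Each is turned into a measure on the
  circle; combining the first with the antipodal image of the second gives a measure \<open>\<mu>\<close> whose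
  odd part is the one prescribed by \<open>h\<close> and whose mass is at most a quarter of the variation. For
  \<open>h = \<partial>\<^sub>- f\<close> the missing mass can be added as a multiple of the symmetric measure \<open>\<H>\<^sup>1\<close> without
  disturbing the odd part. The potential of the sum then has the same left derivative as \<open>f\<close>, and a
  continuous function whose left derivative vanishes is constant, so this potential is \<open>f\<close>. The
  bound \<open>represents_tv_le\<close>, applied to \<open>\<mu>\<close>, shows that the mass of \<open>\<mu>\<close> is exactly a quarter of the
  variation.

  By the same bound, such a \<open>\<mu>\<close> has the least possible mass among the measures with its odd part.
  The difference of two such measures is invariant under the antipodal map, so the smaller one of
  the two on each side of a Hahn decomposition is again a measure with this odd part. Its mass cannot
  be smaller, hence both measures agree.

  That \<open>normalized_H1\<close> is a measure at all is shown by identifying the Hausdorff measure of a Borel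
  set with the Lebesgue measure of its angles in \<open>[0, 2\<pi>)\<close>.
\<close>

section \<open>The circle and its half-open arcs\<close>

abbreviation borel_S1 :: "(real^2) set set" where
  "borel_S1 \<equiv> sets (restrict_space borel S1)"

text \<open>
  Arcs are half-open at their right end: in this form they tile the circle, and the increments of
  a left-continuous left derivative are measures of such arcs.
\<close>
definition circ_arc :: "real \<Rightarrow> real \<Rightarrow> (real^2) set" where
  "circ_arc a b = q ` {a..<b}"

lemma q_eq_iff_cos_sin: "q a = q b \<longleftrightarrow> cos a = cos b \<and> sin a = sin b"
  by (simp add: q_def vec_eq_iff forall_2)

lemma q_in_S1 [simp]: "q t \<in> S1"
  using q_image by blast

lemma q_plus_pi: "q (t + pi) = - q t"
  by (simp add: q_def vec_eq_iff forall_2)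

lemma q_plus_2pi_int: "q (t + 2 * pi * of_int n) = q t"
  by (simp add: q_eq_iff_cos_sin cos_add sin_add cos_int_2pin sin_int_2pin)

lemma q_plus_2pi: "q (t + 2 * pi) = q t"
  by (simp add: q_eq_iff_cos_sin)

lemma uminus_in_S1 [simp]: "- x \<in> S1 \<longleftrightarrow> x \<in> S1"
  by (simp add: S1_def)

lemma uminus_S1: "uminus ` S1 = S1"
  using uminus_in_S1 by (metis (no_types, lifting) equation_minus_iff image_eqI image_subset_iff subsetI subset_antisym)

text \<open>
  The window \<open>[c, c + 2\<pi>)\<close> for the angle is free, so that an angle within \<open>\<pi>\<close> of a given one can be
  chosen; there the spherical distance is the difference of the angles.
\<close>
lemma S1_lift:
  assumes "x \<in> S1"
  obtains t where "x = q t" "c \<le> t" "t < c + 2 * pi"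
proof -
  obtain s where s: "x = q s"
    using assms q_image by blast
  define n where "n = \<lfloor>(s - c) / (2 * pi)\<rfloor>"
  have "of_int n \<le> (s - c) / (2 * pi)" "(s - c) / (2 * pi) < of_int n + 1"
    by (simp_all add: n_def)
  then have "of_int n * (2 * pi) \<le> s - c" "s - c < (of_int n + 1) * (2 * pi)"
    by (simp_all add: pos_le_divide_eq pos_divide_less_eq)
  then have b: "c \<le> s + 2 * pi * of_int (- n)" "s + 2 * pi * of_int (- n) < c + 2 * pi"
    by (simp_all add: algebra_simps)
  have "x = q (s + 2 * pi * of_int (- n))"
    using s q_plus_2pi_int by metis
  then show ?thesis using that b by blast
qed

lemma q_inner: "q a \<bullet> q b = cos (a - b)"
  by (simp add: q_def inner_vec_def sum_2 cos_diff)

lemma q_eq_imp_eq: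
  assumes "q a = q b" "\<bar>a - b\<bar> < 2 * pi"
  shows "a = b"
proof -
  have "cos (a - b) = 1"
    using q_inner[of a b] q_inner[of b b] assms(1) by simp
  then obtain n :: int where n: "a - b = of_int n * 2 * pi"
    using cos_one_2pi_int by blast
  then have "\<bar>real_of_int n\<bar> * (2 * pi) < 1 * (2 * pi)"
    using assms(2) by (simp add: abs_mult)
  then have "\<bar>real_of_int n\<bar> < 1"
    by (rule mult_right_less_imp_less) simp
  then have "n = 0" by linarith
  then show ?thesis using n by simp
qed

lemma circ_arc_Un:
  assumes "a \<le> b" "b \<le> c"
  shows "circ_arc a c = circ_arc a b \<union> circ_arc b c"
  unfolding circ_arc_def image_Un[symmetric] using assms by (simp add: ivl_disj_un)

lemma circ_arc_disjoint:
  assumes "b \<le> c" "d \<le> a + 2 * pi"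
  shows "circ_arc a b \<inter> circ_arc c d = {}"
proof -
  have False if "s \<in> {a..<b}" "t \<in> {c..<d}" "q s = q t" for s t
    using q_eq_imp_eq[OF that(3)] that assms by auto
  then show ?thesis by (fastforce simp: circ_arc_def)
qed

lemma uminus_circ_arc: "uminus ` circ_arc a b = circ_arc (a + pi) (b + pi)"
proof -
  have "circ_arc (a + pi) (b + pi) = q ` ((\<lambda>t. t + pi) ` {a..<b})"
    by (simp only: circ_arc_def image_add_atLeastLessThan')
  also have "\<dots> = uminus ` circ_arc a b"
    by (simp only: circ_arc_def image_image q_plus_pi)
  finally show ?thesis by simp
qed

lemma circ_arc_plus_2pi: "circ_arc (a + 2 * pi) (b + 2 * pi) = circ_arc a b"
proof -
  have "circ_arc (a + 2 * pi) (b + 2 * pi) = q ` ((\<lambda>t. t + 2 * pi) ` {a..<b})"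
    by (simp only: circ_arc_def image_add_atLeastLessThan')
  also have "\<dots> = circ_arc a b"
    by (simp only: circ_arc_def image_image q_plus_2pi)
  finally show ?thesis .
qed

lemma circ_arc_full: "circ_arc a (a + 2 * pi) = S1"
proof
  show "circ_arc a (a + 2 * pi) \<subseteq> S1"
    by (auto simp: circ_arc_def)
  show "S1 \<subseteq> circ_arc a (a + 2 * pi)"
    by (metis S1_lift circ_arc_def atLeastLessThan_iff imageI subsetI)
qed

lemma circ_arc_full': "circ_arc 0 (2 * pi) = S1"
  using circ_arc_full[of 0] by simp

lemma S1_borel: "S1 \<in> sets borel"
  by (simp add: S1_def closed_sphere borel_closed)

lemma borel_S1_iff: "A \<in> borel_S1 \<longleftrightarrow> A \<in> sets borel \<and> A \<subseteq> S1"
  using S1_borel by (auto simp: sets_restrict_space_iff)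

lemma S1_in_borel_S1 [simp]: "S1 \<in> borel_S1"
  using S1_borel by (simp add: borel_S1_iff)

lemma continuous_on_q: "continuous_on T q"
proof -
  have "\<forall>i. continuous_on T (\<lambda>t. (vector [cos t, sin t] :: real^2) $ i)"
    unfolding forall_2 by (simp add: continuous_on_cos continuous_on_sin continuous_on_id)
  then have "continuous_on T (\<lambda>t. \<chi> i. (vector [cos t, sin t] :: real^2) $ i)"
    by (intro continuous_on_vec_lambda) blast
  then show ?thesis
    by (simp only: vec_lambda_eta q_def[abs_def])
qed

lemma circ_arc_borel [simp]: "circ_arc a b \<in> borel_S1"
proof -
  have "{a..<b} = (\<Union>n. {a..b - 1 / real (Suc n)})"
  proof (intro set_eqI iffI)
    fix x assume x: "x \<in> {a..<b}"
    then obtain n where "inverse (real (Suc n)) < b - x"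
      using reals_Archimedean[of "b - x"] by auto
    then show "x \<in> (\<Union>n. {a..b - 1 / real (Suc n)})"
      using x by (auto simp: inverse_eq_divide intro!: exI[of _ n])
  next
    fix x assume "x \<in> (\<Union>n. {a..b - 1 / real (Suc n)})"
    then obtain n where "a \<le> x" "x \<le> b - 1 / real (Suc n)" by auto
    moreover have "0 < 1 / real (Suc n)" by simp
    ultimately show "x \<in> {a..<b}" unfolding atLeastLessThan_iff by linarith
  qed
  then have "circ_arc a b = (\<Union>n. q ` {a..b - 1 / real (Suc n)})"
    by (simp add: circ_arc_def image_UN)
  moreover have "closed (q ` {a..c})" for c
    by (intro compact_imp_closed compact_continuous_image continuous_on_q) simp
  ultimately have "circ_arc a b \<in> sets borel"
    by (auto intro!: sets.countable_UN borel_closed)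
  then show ?thesis
    by (auto simp: borel_S1_iff circ_arc_def)
qed

lemma uminus_borel_S1:
  assumes "A \<in> borel_S1"
  shows "uminus ` A \<in> borel_S1"
proof -
  have "uminus ` A = uminus -` A"
    by (force simp: image_iff)
  moreover have "(uminus :: real^2 \<Rightarrow> real^2) \<in> borel_measurable borel"
    by simp
  then have "uminus -` A \<inter> space borel \<in> sets (borel :: (real^2) measure)"
    using assms by (intro measurable_sets) (auto simp: borel_S1_iff)
  ultimately show ?thesis
    using assms by (auto simp: borel_S1_iff)
qed

section \<open>The spherical distance\<close>

lemma dS1_q: "dS1 (q a) (q b) = arccos (cos (a - b))"
  by (simp add: dS1_def q_inner)

lemma dS1_q_eq:
  assumes "\<bar>a - b\<bar> \<le> pi"
  shows "dS1 (q a) (q b) = \<bar>a - b\<bar>"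
  using assms arccos_cos[of "a - b"] arccos_cos2[of "a - b"] by (auto simp: dS1_q abs_if)

lemma inner_S1_bounds:
  assumes "x \<in> S1" "y \<in> S1"
  shows "- 1 \<le> x \<bullet> y" "x \<bullet> y \<le> 1"
  using assms Cauchy_Schwarz_ineq2[of x y] by (auto simp: S1_def)

lemma dS1_bounds:
  assumes "x \<in> S1" "y \<in> S1"
  shows "0 \<le> dS1 x y" "dS1 x y \<le> pi"
  using inner_S1_bounds[OF assms] by (auto simp: dS1_def arccos_lbound arccos_ubound)

lemma dS1_q_le: "dS1 (q a) (q b) \<le> \<bar>a - b\<bar>"
  using dS1_q_eq[of a b] dS1_bounds(2)[of "q a" "q b"] by (cases "\<bar>a - b\<bar> \<le> pi") auto

lemma dS1_commute: "dS1 x y = dS1 y x"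
  by (simp add: dS1_def inner_commute)

lemma dS1_triangle:
  assumes "x \<in> S1" "y \<in> S1" "z \<in> S1"
  shows "dS1 x z \<le> dS1 x y + dS1 y z"
proof -
  obtain b where b: "y = q b"
    using S1_lift[OF assms(2)] by metis
  obtain a where a: "x = q a" "b - pi \<le> a" "a < b - pi + 2 * pi"
    using S1_lift[OF assms(1)] by metis
  obtain c where c: "z = q c" "b - pi \<le> c" "c < b - pi + 2 * pi"
    using S1_lift[OF assms(3)] by metis
  have "dS1 x z \<le> \<bar>a - c\<bar>"
    using a c dS1_q_le by simp
  also have "\<dots> \<le> \<bar>a - b\<bar> + \<bar>b - c\<bar>"
    by simp
  also have "\<dots> = dS1 x y + dS1 y z"
    using a b c by (simp add: dS1_q_eq)
  finally show ?thesis .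
qed

lemma dS1_antipode:
  assumes "x \<in> S1" "y \<in> S1"
  shows "dS1 x y + dS1 (- x) y = pi"
  using inner_S1_bounds[OF assms] by (simp add: dS1_def arccos_minus)

lemma dS1_borel_measurable [measurable]: "dS1 x \<in> borel_measurable (restrict_space borel S1)"
  if "x \<in> S1"
proof -
  have "continuous_on S1 (\<lambda>y. arccos (x \<bullet> y))"
    using inner_S1_bounds[OF that] by (intro continuous_intros) auto
  then show ?thesis
    unfolding dS1_def by (rule borel_measurable_continuous_on_restrict)
qed

section \<open>Finite Borel measures on the circle\<close>

lemma finite_borel_S1D:
  assumes "finite_borel_S1 \<nu>"
  shows "sets \<nu> = borel_S1" "space \<nu> = S1" "finite_measure \<nu>"
  using assms sets_eq_imp_space_eq[of \<nu> "restrict_space borel S1"]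
  by (auto simp: finite_borel_S1_def space_restrict_space)

text \<open>
  Linear combinations of measures and measures glued from pieces of two others are
  first written down as a real-valued set function and obtained from this lemma.
\<close>
lemma finite_borel_S1_exists:
  fixes m :: "(real^2) set \<Rightarrow> real"
  assumes nonneg: "\<And>A. A \<in> borel_S1 \<Longrightarrow> 0 \<le> m A"
    and sums: "\<And>A :: nat \<Rightarrow> _. range A \<subseteq> borel_S1 \<Longrightarrow> disjoint_family A \<Longrightarrow> (\<lambda>i. m (A i)) sums m (\<Union>i. A i)"
  shows "\<exists>\<mu>. finite_borel_S1 \<mu> \<and> (\<forall>A\<in>borel_S1. measure \<mu> A = m A)"
proof -
  define \<mu> where "\<mu> = measure_of S1 borel_S1 (\<lambda>A. ennreal (m A))"
  have sp: "space (restrict_space borel S1) = S1"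
    by (simp add: space_restrict_space)
  interpret sigma_algebra S1 borel_S1
    using sets.sigma_algebra_axioms[of "restrict_space borel S1"] by (simp add: sp)
  have sets: "sets \<mu> = borel_S1"
    by (simp add: \<mu>_def sets_measure_of_eq)
  have "m {} = 0"
  proof -
    have "(\<lambda>i::nat. m {}) sums m (\<Union>i::nat. {})"
      by (rule sums) (auto simp: disjoint_family_on_def)
    then have "(\<lambda>i::nat. m {}) \<longlonglongrightarrow> 0"
      by (auto simp: sums_iff intro: summable_LIMSEQ_zero)
    then show ?thesis
      by (simp add: LIMSEQ_const_iff)
  qed
  then have "positive borel_S1 (\<lambda>A. ennreal (m A))"
    by (simp add: positive_def)
  moreover have "countably_additive borel_S1 (\<lambda>A. ennreal (m A))"
  proof (unfold countably_additive_def, intro allI impI)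
    fix A :: "nat \<Rightarrow> (real^2) set"
    assume A: "range A \<subseteq> borel_S1" "disjoint_family A" "(\<Union>i. A i) \<in> borel_S1"
    then show "(\<Sum>i. ennreal (m (A i))) = ennreal (m (\<Union>i. A i))"
      using sums[OF A(1,2)] nonneg by (intro suminf_ennreal_eq) auto
  qed
  ultimately have em: "emeasure \<mu> A = ennreal (m A)" if "A \<in> borel_S1" for A
    using that emeasure_measure_of_sigma[OF sigma_algebra_axioms] by (simp add: \<mu>_def)
  have "finite_borel_S1 \<mu>"
    using em[of S1] sets sets_eq_imp_space_eq[of \<mu> "restrict_space borel S1"]
    by (auto simp: finite_borel_S1_def sp intro!: finite_measureI)
  moreover have "measure \<mu> A = m A" if "A \<in> borel_S1" for A
    using em nonneg that by (simp add: measure_def)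
  ultimately show ?thesis by blast
qed

text \<open>
  Countable additivity in the form that feeds \<open>finite_borel_S1_exists\<close>, for a measure and for its
  antipodal image.
\<close>
lemma finite_borel_S1_sums:
  fixes A :: "nat \<Rightarrow> _"
  assumes "finite_borel_S1 \<nu>" "range A \<subseteq> borel_S1" "disjoint_family A"
  shows "(\<lambda>i. measure \<nu> (A i)) sums measure \<nu> (\<Union>i. A i)"
    and "(\<lambda>i. measure \<nu> (uminus ` A i)) sums measure \<nu> (uminus ` (\<Union>i. A i))"
proof -
  interpret finite_measure \<nu>
    using assms(1) by (rule finite_borel_S1D)
  have s: "sets \<nu> = borel_S1"
    using assms(1) by (rule finite_borel_S1D)
  show "(\<lambda>i. measure \<nu> (A i)) sums measure \<nu> (\<Union>i. A i)"
    using assms s by (intro finite_measure_UNION) auto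
  have "disjoint_family (\<lambda>i. uminus ` A i)"
    using assms(3) unfolding disjoint_family_on_def by (metis image_Int_subset image_empty image_Int inj_uminus)
  then show "(\<lambda>i. measure \<nu> (uminus ` A i)) sums measure \<nu> (uminus ` (\<Union>i. A i))"
    using assms s uminus_borel_S1 unfolding image_UN by (intro finite_measure_UNION) auto
qed

text \<open>
  The inverse of \<^const>\<open>q\<close> on \<open>[0, 2\<pi>)\<close>. It is written in terms of the spherical distance from
  \<open>q 0\<close>, whose measurability is known.
\<close>
definition circ_angle :: "real^2 \<Rightarrow> real" where
  "circ_angle x = (if 0 \<le> x $ 2 then dS1 (q 0) x else 2 * pi - dS1 (q 0) x)"

lemma circ_angle_q:
  assumes "0 \<le> t" "t < 2 * pi"
  shows "circ_angle (q t) = t"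
proof (cases "t \<le> pi")
  case True
  then show ?thesis
    using assms sin_ge_zero[of t] dS1_q_eq[of 0 t] by (simp add: circ_angle_def q_def)
next
  case False
  then have "sin (t - pi) > 0"
    using assms by (intro sin_gt_zero) auto
  then have "sin t < 0"
    by (simp add: sin_diff)
  moreover have "dS1 (q 0) (q t) = 2 * pi - t"
    using False assms dS1_q_eq[of "0 + 2 * pi" t] unfolding q_plus_2pi by simp
  ultimately show ?thesis
    by (simp add: circ_angle_def) (simp add: q_def)
qed

lemma circ_angle_measurable: "circ_angle \<in> borel_measurable (restrict_space borel S1)"
proof -
  have nth: "(\<lambda>x::real^2. x $ 2) \<in> borel_measurable (restrict_space borel S1)"
    by (intro borel_measurable_continuous_on_restrict continuous_intros)
  then have "{x \<in> space (restrict_space borel S1). 0 \<le> (x :: real^2) $ 2} \<in> borel_S1"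
    by measurable
  then show ?thesis
    unfolding circ_angle_def using dS1_borel_measurable[OF q_in_S1]
    by (intro measurable_If borel_measurable_diff borel_measurable_const)
qed

text \<open>
  The angle map carries the initial arcs to initial segments of \<open>[0, 2\<pi>)\<close>, which form a generator of
  the Borel sets of the line that is stable under intersections.
\<close>
lemma measure_eqI_initial_arcs:
  assumes "finite_borel_S1 \<mu>" "finite_borel_S1 \<nu>"
    and eq: "\<And>b. 0 \<le> b \<Longrightarrow> b \<le> 2 * pi \<Longrightarrow> measure \<mu> (circ_arc 0 b) = measure \<nu> (circ_arc 0 b)"
  shows "\<mu> = \<nu>"
proof -
  have arcs: "circ_angle -` {..<b} \<inter> S1 = circ_arc 0 (max 0 (min b (2 * pi)))" for b
  proof (intro set_eqI iffI)
    fix x assume x: "x \<in> circ_angle -` {..<b} \<inter> S1"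
    then obtain t where "x = q t" "0 \<le> t" "t < 2 * pi"
      using S1_lift[of x 0] by auto
    then show "x \<in> circ_arc 0 (max 0 (min b (2 * pi)))"
      using x circ_angle_q by (auto simp: circ_arc_def)
  next
    fix x assume "x \<in> circ_arc 0 (max 0 (min b (2 * pi)))"
    then show "x \<in> circ_angle -` {..<b} \<inter> S1"
      using circ_angle_q by (auto simp: circ_arc_def)
  qed
  have meas: "circ_angle \<in> measurable M borel" if "finite_borel_S1 M" for M
    using circ_angle_measurable that
    by (subst measurable_cong_sets[OF finite_borel_S1D(1) refl]) auto
  have distr: "emeasure (distr M borel circ_angle) {..<b} = ennreal (measure M (circ_arc 0 (max 0 (min b (2 * pi)))))"
    if "finite_borel_S1 M" for M b
    using finite_borel_S1D[OF that] meas[OF that]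
    by (simp add: emeasure_distr arcs finite_measure.emeasure_eq_measure)
  have dd: "distr \<mu> borel circ_angle = distr \<nu> borel circ_angle"
  proof (rule measure_eqI_generator_eq[where E = "range lessThan" and \<Omega> = UNIV and A = "\<lambda>n. {..<real n}"])
    have "{..<a} \<inter> {..<b} = {..<min a b}" for a b :: real
      by auto
    then show "Int_stable (range (lessThan :: real \<Rightarrow> _))"
      by (auto simp: Int_stable_def)
    show "emeasure (distr \<mu> borel circ_angle) X = emeasure (distr \<nu> borel circ_angle) X"
      if "X \<in> range lessThan" for X
      using that distr assms by auto
    show "(\<Union>n. {..<real n}) = UNIV"
      using reals_Archimedean2 by auto
    show "emeasure (distr \<mu> borel circ_angle) {..<real n} \<noteq> \<infinity>" for n
      using distr assms by simp
  qed (auto simp: borel_Iio)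
  show ?thesis
  proof (rule measure_eqI)
    show "sets \<mu> = sets \<nu>"
      using assms finite_borel_S1D by simp
    fix A assume "A \<in> sets \<mu>"
    then have A: "A \<in> borel_S1"
      using assms finite_borel_S1D by simp
    then have B: "q -` A \<inter> {0..<2 * pi} \<in> sets borel"
      using measurable_sets[OF borel_measurable_continuous_onI[OF continuous_on_q[of UNIV]], of A]
      by (auto simp: borel_S1_iff)
    have pre: "circ_angle -` (q -` A \<inter> {0..<2 * pi}) \<inter> S1 = A"
    proof (intro set_eqI iffI)
      fix x assume x: "x \<in> circ_angle -` (q -` A \<inter> {0..<2 * pi}) \<inter> S1"
      then obtain t where "x = q t" "0 \<le> t" "t < 2 * pi"
        using S1_lift[of x 0] by auto
      then show "x \<in> A" using x circ_angle_q by auto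
    next
      fix x assume x: "x \<in> A"
      then have "x \<in> S1"
        using A by (auto simp: borel_S1_iff)
      then obtain t where "x = q t" "0 \<le> t" "t < 2 * pi"
        using S1_lift[of x 0] by auto
      then show "x \<in> circ_angle -` (q -` A \<inter> {0..<2 * pi}) \<inter> S1"
        using x circ_angle_q by auto
    qed
    have "emeasure M A = emeasure (distr M borel circ_angle) (q -` A \<inter> {0..<2 * pi})"
      if "finite_borel_S1 M" for M
      using finite_borel_S1D[OF that] meas[OF that] B by (simp add: emeasure_distr pre del: vimage_Int)
    then show "emeasure \<mu> A = emeasure \<nu> A"
      using dd assms by simp
  qed
qed

section \<open>The left derivative of a potential\<close>

lemma circ_arc_measure_Un:
  assumes "finite_borel_S1 \<nu>" "a \<le> b" "b \<le> c" "c \<le> a + 2 * pi"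
  shows "measure \<nu> (circ_arc a c) = measure \<nu> (circ_arc a b) + measure \<nu> (circ_arc b c)"
proof -
  interpret finite_measure \<nu>
    using assms(1) by (rule finite_borel_S1D)
  show ?thesis
    using assms circ_arc_Un[of a b c] circ_arc_disjoint[of b b c a] finite_borel_S1D(1)[of \<nu>]
    by (simp add: finite_measure_Union)
qed

lemma dS1_integrable:
  assumes "finite_borel_S1 \<nu>" "x \<in> S1"
  shows "integrable \<nu> (dS1 x)"
proof -
  interpret finite_measure \<nu>
    using assms(1) by (rule finite_borel_S1D)
  show ?thesis
  proof (rule integrable_const_bound[where B = pi])
    show "AE y in \<nu>. norm (dS1 x y) \<le> pi"
      using dS1_bounds[OF assms(2)] finite_borel_S1D(2)[OF assms(1)] by (intro AE_I2) auto
    show "dS1 x \<in> borel_measurable \<nu>"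
      using dS1_borel_measurable[OF assms(2)]
      by (subst measurable_cong_sets[OF finite_borel_S1D(1)[OF assms(1)] refl])
  qed
qed

lemma represents_antipode_sum:
  assumes "finite_borel_S1 \<nu>" "represents \<nu> f" "x \<in> S1"
  shows "f x + f (- x) = pi * measure \<nu> S1"
proof -
  have "f x + f (- x) = (\<integral>y. dS1 x y + dS1 (- x) y \<partial>\<nu>)"
    using assms dS1_integrable by (simp add: represents_def)
  also have "\<dots> = (\<integral>y. pi \<partial>\<nu>)"
    using dS1_antipode[OF assms(3)] finite_borel_S1D(2)[OF assms(1)]
    by (intro Bochner_Integration.integral_cong) auto
  finally show ?thesis
    using finite_borel_S1D(2)[OF assms(1)] by simp
qed

lemma represents_lipschitz:
  assumes "finite_borel_S1 \<nu>" "represents \<nu> f"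
  shows "lipschitz_S1 f"
  unfolding lipschitz_S1_def
proof (intro exI ballI)
  interpret finite_measure \<nu>
    using assms(1) by (rule finite_borel_S1D)
  fix x y assume xy: "x \<in> S1" "y \<in> S1"
  have "\<bar>f x - f y\<bar> = \<bar>\<integral>z. dS1 x z - dS1 y z \<partial>\<nu>\<bar>"
    using assms xy dS1_integrable by (simp add: represents_def)
  also have "\<dots> \<le> (\<integral>z. \<bar>dS1 x z - dS1 y z\<bar> \<partial>\<nu>)"
    by (rule integral_abs_bound)
  also have "\<dots> \<le> (\<integral>z. dS1 x y \<partial>\<nu>)"
  proof (rule integral_mono)
    show "integrable \<nu> (\<lambda>z. \<bar>dS1 x z - dS1 y z\<bar>)"
      using assms xy dS1_integrable by (intro integrable_abs Bochner_Integration.integrable_diff) auto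
    fix z assume "z \<in> space \<nu>"
    then have "z \<in> S1"
      using finite_borel_S1D(2)[OF assms(1)] by simp
    then show "\<bar>dS1 x z - dS1 y z\<bar> \<le> dS1 x y"
      using dS1_triangle[OF xy, of z] dS1_triangle[OF xy(2,1), of z] dS1_commute[of x y] by (simp add: abs_le_iff)
  qed simp
  also have "\<dots> = measure \<nu> S1 * dS1 x y"
    using finite_borel_S1D(2)[OF assms(1)] by simp
  finally show "\<bar>f x - f y\<bar> \<le> measure \<nu> S1 * dS1 x y" .
qed

lemma left_derivI:
  assumes "((\<lambda>t. (f (q (a + t)) - f (q a)) / t) \<longlongrightarrow> l) (at_left 0)"
  shows "left_deriv f (q a) = l"
  unfolding left_deriv_def circ_add_q by (rule tendsto_Lim[OF trivial_limit_at_left_real assms])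

lemma left_deriv_tendsto:
  assumes "left_differentiable f"
  shows "((\<lambda>t. (f (q (a + t)) - f (q a)) / t) \<longlongrightarrow> left_deriv f (q a)) (at_left 0)"
proof -
  have "\<exists>l. ((\<lambda>t. (f (circ_add (q a) t) - f (q a)) / t) \<longlongrightarrow> l) (at_left 0)"
    using assms unfolding left_differentiable_def by simp
  then obtain l where "((\<lambda>t. (f (q (a + t)) - f (q a)) / t) \<longlongrightarrow> l) (at_left 0)"
    unfolding circ_add_q by blast
  then show ?thesis
    using left_derivI by blast
qed

lemma left_differentiableI:
  assumes "\<And>a. ((\<lambda>t. (f (q (a + t)) - f (q a)) / t) \<longlongrightarrow> l a) (at_left 0)"
  shows "left_differentiable f"
proof -
  have "\<exists>l. ((\<lambda>t. (f (circ_add x t) - f x) / t) \<longlongrightarrow> l) (at_left 0)" if x_S1: "x \<in> S1" for x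
  proof -
    obtain a where x: "x = q a"
      using S1_lift[OF x_S1] by metis
    show ?thesis
      unfolding x circ_add_q by (rule exI[of _ "l a"]) (rule assms)
  qed
  then show ?thesis
    by (simp add: left_differentiable_def)
qed

text \<open>
  The difference quotient of the distance to a fixed point is bounded by \<open>1\<close>, since the distance is
  \<open>1\<close>-Lipschitz. Between \<open>a\<close> and a slightly smaller angle it is eventually constant, namely
  \<open>1\<close> for points in \<open>[a - \<pi>, a)\<close> and \<open>- 1\<close> for points in \<open>[a, a + \<pi>)\<close>. Dominated convergence integrates
  this.
\<close>
lemma represents_left_deriv_tendsto:
  assumes \<nu>: "finite_borel_S1 \<nu>" and rep: "represents \<nu> f"
  shows "((\<lambda>t. (f (q (a + t)) - f (q a)) / t) \<longlongrightarrow>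
            measure \<nu> (circ_arc (a - pi) a) - measure \<nu> (circ_arc a (a + pi))) (at_left 0)"
proof (rule tendsto_at_left_sequentially[of "- 1"])
  interpret finite_measure \<nu>
    using \<nu> by (rule finite_borel_S1D)
  note sets = finite_borel_S1D(1)[OF \<nu>] and space = finite_borel_S1D(2)[OF \<nu>]
  let ?g = "\<lambda>y. indicator (circ_arc (a - pi) a) y - indicator (circ_arc a (a + pi)) y :: real"
  fix S :: "nat \<Rightarrow> real"
  assume S: "\<And>n. S n < 0" "S \<longlonglongrightarrow> 0"
  have "(\<lambda>n. \<integral>y. (dS1 (q (a + S n)) y - dS1 (q a) y) / S n \<partial>\<nu>) \<longlonglongrightarrow> (\<integral>y. ?g y \<partial>\<nu>)"
  proof (rule integral_dominated_convergence[where w = "\<lambda>_. 1"])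
    have m: "dS1 (q t) \<in> borel_measurable \<nu>" for t
      using dS1_integrable[OF \<nu>, of "q t"] by simp
    show "(\<lambda>y. (dS1 (q (a + S n)) y - dS1 (q a) y) / S n) \<in> borel_measurable \<nu>" for n
      using m by (intro borel_measurable_divide borel_measurable_diff) auto
    show "?g \<in> borel_measurable \<nu>"
      using sets by (intro borel_measurable_diff borel_measurable_indicator) auto
    show "integrable \<nu> (\<lambda>_. 1 :: real)" by simp
    show "AE y in \<nu>. norm ((dS1 (q (a + S n)) y - dS1 (q a) y) / S n) \<le> 1" for n
    proof (rule AE_I2)
      fix y assume "y \<in> space \<nu>"
      then have "y \<in> S1" using space by simp
      then have "\<bar>dS1 (q (a + S n)) y - dS1 (q a) y\<bar> \<le> dS1 (q (a + S n)) (q a)"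
        using dS1_triangle[of "q (a + S n)" "q a" y] dS1_triangle[of "q a" "q (a + S n)" y]
          dS1_commute[of "q (a + S n)" "q a"] by (simp add: abs_le_iff)
      also have "\<dots> \<le> \<bar>S n\<bar>"
        using dS1_q_le[of "a + S n" a] by simp
      finally show "norm ((dS1 (q (a + S n)) y - dS1 (q a) y) / S n) \<le> 1"
        using S(1)[of n] by (simp add: abs_divide neg_le_divide_eq)
    qed
    show "AE y in \<nu>. (\<lambda>n. (dS1 (q (a + S n)) y - dS1 (q a) y) / S n) \<longlonglongrightarrow> ?g y"
    proof (rule AE_I2)
      fix y assume "y \<in> space \<nu>"
      then obtain b where b: "y = q b" "a - pi \<le> b" "b < a - pi + 2 * pi"
        using S1_lift[of y "a - pi"] space by auto
      show "(\<lambda>n. (dS1 (q (a + S n)) y - dS1 (q a) y) / S n) \<longlonglongrightarrow> ?g y"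
      proof (cases "b < a")
        case True
        then have "y \<in> circ_arc (a - pi) a"
          using b by (auto simp: circ_arc_def)
        moreover have "y \<notin> circ_arc a (a + pi)"
          using calculation circ_arc_disjoint[of a a "a + pi" "a - pi"] by auto
        ultimately have g: "?g y = 1" by simp
        have "eventually (\<lambda>n. b - a < S n) sequentially"
          using order_tendstoD(1)[OF S(2)] True by simp
        then have "eventually (\<lambda>n. 1 = (dS1 (q (a + S n)) y - dS1 (q a) y) / S n) sequentially"
        proof eventually_elim
          case (elim n)
          have "dS1 (q (a + S n)) y = a + S n - b" "dS1 (q a) y = a - b"
            using elim b True S(1)[of n] by (simp_all add: dS1_q_eq)
          then show ?case using S(1)[of n] by simp
        qed
        then show ?thesis
          unfolding g by (rule Lim_transform_eventually[OF tendsto_const])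
      next
        case False
        then have "y \<in> circ_arc a (a + pi)"
          using b by (auto simp: circ_arc_def)
        moreover have "y \<notin> circ_arc (a - pi) a"
          using calculation circ_arc_disjoint[of a a "a + pi" "a - pi"] by auto
        ultimately have g: "?g y = - 1" by simp
        have "eventually (\<lambda>n. b - a - pi < S n) sequentially"
          using order_tendstoD(1)[OF S(2)] b by simp
        then have "eventually (\<lambda>n. - 1 = (dS1 (q (a + S n)) y - dS1 (q a) y) / S n) sequentially"
        proof eventually_elim
          case (elim n)
          have "dS1 (q (a + S n)) y = b - a - S n" "dS1 (q a) y = b - a"
            using elim b False S(1)[of n] by (simp_all add: dS1_q_eq)
          then show ?case using S(1)[of n] by simp
        qed
        then show ?thesis
          unfolding g by (rule Lim_transform_eventually[OF tendsto_const])
      qed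
    qed
  qed
  moreover have "integrable \<nu> (indicator A :: _ \<Rightarrow> real)" if "A \<in> borel_S1" for A
    using sets that by (intro integrable_real_indicator) (auto simp: emeasure_eq_measure)
  then have "(\<integral>y. ?g y \<partial>\<nu>) = measure \<nu> (circ_arc (a - pi) a) - measure \<nu> (circ_arc a (a + pi))"
    using sets sets.Int_space_eq2[of _ \<nu>] by simp
  moreover have "(\<integral>y. (dS1 (q (a + S n)) y - dS1 (q a) y) / S n \<partial>\<nu>) = (f (q (a + S n)) - f (q a)) / S n" for n
    using rep dS1_integrable[OF \<nu>] by (simp add: represents_def)
  ultimately show "(\<lambda>n. (f (q (a + S n)) - f (q a)) / S n) \<longlonglongrightarrow>
      measure \<nu> (circ_arc (a - pi) a) - measure \<nu> (circ_arc a (a + pi))"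
    by (simp only:)
qed simp

lemma represents_left_differentiable:
  assumes "finite_borel_S1 \<nu>" "represents \<nu> f"
  shows "left_differentiable f"
  using represents_left_deriv_tendsto[OF assms] by (rule left_differentiableI)

lemma represents_left_deriv:
  assumes "finite_borel_S1 \<nu>" "represents \<nu> f"
  shows "left_deriv f (q a) = measure \<nu> (circ_arc (a - pi) a) - measure \<nu> (circ_arc a (a + pi))"
  using represents_left_deriv_tendsto[OF assms] by (rule left_derivI)

text \<open>
  Moving both half circles of \<open>represents_left_deriv\<close> from \<open>a\<close> to \<open>b\<close> moves the arc \<open>[a, b)\<close> from the
  part ahead to the part behind, and its antipode the other way. This needs \<open>b \<le> a + \<pi>\<close>; longer
  arcs are halved.
\<close>
lemma represents_left_deriv_increment:
  assumes \<nu>: "finite_borel_S1 \<nu>" "represents \<nu> f" and ab: "a \<le> b" "b \<le> a + 2 * pi"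
  shows "left_deriv f (q b) - left_deriv f (q a) =
           2 * (measure \<nu> (circ_arc a b) - measure \<nu> (uminus ` circ_arc a b))"
proof -
  have short: "left_deriv f (q b) - left_deriv f (q a) =
           2 * (measure \<nu> (circ_arc a b) - measure \<nu> (uminus ` circ_arc a b))"
    if ab: "a \<le> b" "b \<le> a + pi" for a b
  proof -
    have "measure \<nu> (circ_arc (a - pi) a) = measure \<nu> (circ_arc (a - pi) (b - pi)) + measure \<nu> (circ_arc (b - pi) a)"
      "measure \<nu> (circ_arc (b - pi) b) = measure \<nu> (circ_arc (b - pi) a) + measure \<nu> (circ_arc a b)"
      "measure \<nu> (circ_arc a (a + pi)) = measure \<nu> (circ_arc a b) + measure \<nu> (circ_arc b (a + pi))"
      "measure \<nu> (circ_arc b (b + pi)) = measure \<nu> (circ_arc b (a + pi)) + measure \<nu> (circ_arc (a + pi) (b + pi))"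
      using ab by (auto intro!: circ_arc_measure_Un[OF \<nu>(1)])
    moreover have "circ_arc (a - pi) (b - pi) = circ_arc (a + pi) (b + pi)"
      using circ_arc_plus_2pi[of "a - pi" "b - pi"] by (simp add: algebra_simps)
    ultimately show ?thesis
      by (simp add: represents_left_deriv[OF \<nu>] uminus_circ_arc)
  qed
  define m where "m = (a + b) / 2"
  have m: "a \<le> m" "m \<le> a + pi" "m \<le> b" "b \<le> m + pi"
    using ab by (auto simp: m_def field_simps)
  have "measure \<nu> (circ_arc a b) = measure \<nu> (circ_arc a m) + measure \<nu> (circ_arc m b)"
    "measure \<nu> (uminus ` circ_arc a b) = measure \<nu> (uminus ` circ_arc a m) + measure \<nu> (uminus ` circ_arc m b)"
    unfolding uminus_circ_arc using m ab by (auto intro!: circ_arc_measure_Un[OF \<nu>(1)])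
  then show ?thesis
    using short[OF m(1,2)] short[OF m(3,4)] by simp
qed

text \<open>
  On each piece of a partition the increment is twice the difference of the \<open>\<kappa>\<close>-measures of an arc
  and its antipode, hence at most twice their sum, and both families of arcs tile the circle. The
  freedom to choose \<open>\<kappa>\<close> different from \<open>\<nu>\<close> gives the lower bound for the mass in the existence and
  uniqueness proofs.
\<close>
lemma represents_tv_le:
  assumes \<nu>: "finite_borel_S1 \<nu>" "represents \<nu> f" and \<kappa>: "finite_borel_S1 \<kappa>"
    and odd: "\<And>A. A \<in> borel_S1 \<Longrightarrow>
      measure \<kappa> A - measure \<kappa> (uminus ` A) = measure \<nu> A - measure \<nu> (uminus ` A)"
  shows "tv_S1 (left_deriv f) \<le> ennreal (4 * measure \<kappa> S1)"
  unfolding tv_S1_def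
proof (rule SUP_least, clarify)
  fix n :: nat and t :: "nat \<Rightarrow> real"
  assume t: "t 0 = 0" "t (Suc n) = 2 * pi" "\<forall>i\<le>n. t i \<le> t (Suc i)"
  have mono: "t i \<le> t j" if "i \<le> j" "j \<le> Suc n" for i j
    using that
  proof (induction j rule: dec_induct)
    case (step k)
    then have "t i \<le> t k" "t k \<le> t (Suc k)" using t(3) by auto
    then show ?case by (rule order_trans)
  qed simp
  have inc: "\<bar>left_deriv f (q (t i)) - left_deriv f (q (t (Suc i)))\<bar>
      \<le> 2 * (measure \<kappa> (circ_arc (t i) (t (Suc i))) + measure \<kappa> (uminus ` circ_arc (t i) (t (Suc i))))"
    if "i \<le> n" for i
  proof -
    have "t i \<le> t (Suc i)" "t (Suc i) \<le> t i + 2 * pi"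
      using that mono[of i "Suc i"] mono[of 0 i] mono[of "Suc i" "Suc n"] t by auto
    from represents_left_deriv_increment[OF \<nu> this] odd[OF circ_arc_borel, of "t i" "t (Suc i)"]
    have "left_deriv f (q (t (Suc i))) - left_deriv f (q (t i)) = 2 *
        (measure \<kappa> (circ_arc (t i) (t (Suc i))) - measure \<kappa> (uminus ` circ_arc (t i) (t (Suc i))))"
      by simp
    moreover have "\<bar>x - y\<bar> \<le> 2 * (u + v)" if "y - x = 2 * (u - v)" "0 \<le> u" "0 \<le> v" for x y u v :: real
      using that by (simp add: abs_if)
    ultimately show ?thesis
      using measure_nonneg by metis
  qed
  have tele: "(\<Sum>i=0..<k. measure \<kappa> (circ_arc (t i + c) (t (Suc i) + c))) = measure \<kappa> (circ_arc c (t k + c))"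
    if "k \<le> Suc n" for k c
    using that
  proof (induction k)
    case 0
    then show ?case by (simp add: t circ_arc_def)
  next
    case (Suc k)
    then show ?case
      using mono[of 0 k] mono[of k "Suc k"] mono[of "Suc k" "Suc n"] t
        circ_arc_measure_Un[OF \<kappa>, of c "t k + c" "t (Suc k) + c"] by simp
  qed
  have "(\<Sum>i=0..n. \<bar>left_deriv f (q (t i)) - left_deriv f (q (t (Suc i)))\<bar>)
      \<le> (\<Sum>i=0..n. 2 * (measure \<kappa> (circ_arc (t i) (t (Suc i))) + measure \<kappa> (uminus ` circ_arc (t i) (t (Suc i)))))"
    using inc by (intro sum_mono) auto
  also have "\<dots> = 2 * ((\<Sum>i=0..<Suc n. measure \<kappa> (circ_arc (t i + 0) (t (Suc i) + 0)))
      + (\<Sum>i=0..<Suc n. measure \<kappa> (circ_arc (t i + pi) (t (Suc i) + pi))))"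
    unfolding uminus_circ_arc atLeastLessThanSuc_atLeastAtMost by (simp add: sum.distrib sum_distrib_left)
  also have "\<dots> = 4 * measure \<kappa> S1"
    using tele[of "Suc n" 0] tele[of "Suc n" pi] circ_arc_full[of pi] by (simp add: t circ_arc_full' add.commute)
  finally show "ennreal (\<Sum>i=0..n. \<bar>left_deriv f (q (t i)) - left_deriv f (q (t (Suc i)))\<bar>) \<le> ennreal (4 * measure \<kappa> S1)"
    by (rule ennreal_leI)
qed

text \<open>
  Equality of the odd parts is rewritten as equality of two nonnegative measures, \<open>\<mu> + \<nu>\<^sup>-\<close> and
  \<open>\<nu> + \<mu>\<^sup>-\<close>, so that agreement on initial arcs suffices.
\<close>
lemma represents_odd_part_unique:
  assumes \<mu>: "finite_borel_S1 \<mu>" "represents \<mu> f" and \<nu>: "finite_borel_S1 \<nu>" "represents \<nu> f"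
    and A: "A \<in> borel_S1"
  shows "measure \<mu> A - measure \<mu> (uminus ` A) = measure \<nu> A - measure \<nu> (uminus ` A)"
proof -
  have "\<exists>\<kappa>. finite_borel_S1 \<kappa> \<and> (\<forall>A\<in>borel_S1. measure \<kappa> A = measure \<alpha> A + measure \<beta> (uminus ` A))"
    if "finite_borel_S1 \<alpha>" "finite_borel_S1 \<beta>" for \<alpha> \<beta>
    using that finite_borel_S1_sums
    by (intro finite_borel_S1_exists sums_add) auto
  from this[OF \<mu>(1) \<nu>(1)] this[OF \<nu>(1) \<mu>(1)] obtain \<kappa> \<kappa>' where
    \<kappa>: "finite_borel_S1 \<kappa>" "\<And>A. A \<in> borel_S1 \<Longrightarrow> measure \<kappa> A = measure \<mu> A + measure \<nu> (uminus ` A)" and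
    \<kappa>': "finite_borel_S1 \<kappa>'" "\<And>A. A \<in> borel_S1 \<Longrightarrow> measure \<kappa>' A = measure \<nu> A + measure \<mu> (uminus ` A)"
    by blast
  have "\<kappa> = \<kappa>'"
  proof (rule measure_eqI_initial_arcs[OF \<kappa>(1) \<kappa>'(1)])
    fix b :: real assume "0 \<le> b" "b \<le> 2 * pi"
    then show "measure \<kappa> (circ_arc 0 b) = measure \<kappa>' (circ_arc 0 b)"
      using represents_left_deriv_increment[OF \<mu>, of 0 b] represents_left_deriv_increment[OF \<nu>, of 0 b]
      by (simp add: \<kappa>(2) \<kappa>'(2))
  qed
  then show ?thesis
    using \<kappa>(2)[OF A] \<kappa>'(2)[OF A] by simp
qed

section \<open>The Hausdorff measure of the circle\<close>

lemma dS1_le_diam_S1: "x \<in> U \<Longrightarrow> y \<in> U \<Longrightarrow> ennreal (dS1 x y) \<le> diam_S1 U"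
  unfolding diam_S1_def by (meson SUP_upper2 SUP_upper)

lemma diam_S1_empty [simp]: "diam_S1 {} = 0"
  by (simp add: diam_S1_def bot_ennreal)

lemma diam_S1_arc_le:
  assumes "a \<le> b"
  shows "diam_S1 (q ` {a..b}) \<le> ennreal (b - a)"
  unfolding diam_S1_def
proof (intro SUP_least)
  fix x y assume "x \<in> q ` {a..b}" "y \<in> q ` {a..b}"
  then obtain s t where "x = q s" "y = q t" "s \<in> {a..b}" "t \<in> {a..b}"
    by blast
  then show "ennreal (dS1 x y) \<le> ennreal (b - a)"
    using dS1_q_le[of s t] by (intro ennreal_leI) auto
qed

lemma hausdorff1_pre_le:
  assumes "\<And>i. U i \<subseteq> S1" "\<And>i. diam_S1 (U i) \<le> ennreal \<delta>" "A \<subseteq> (\<Union>i. U i)"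
  shows "hausdorff1_pre \<delta> A \<le> (\<Sum>i. diam_S1 (U i))"
  unfolding hausdorff1_pre_def using assms by (intro INF_lower) auto

lemma hausdorff1_pre_mono: "A \<subseteq> B \<Longrightarrow> hausdorff1_pre \<delta> A \<le> hausdorff1_pre \<delta> B"
  unfolding hausdorff1_pre_def by (intro INF_superset_mono) auto

text \<open>
  The usual argument: cover the \<open>i\<close>-th set up to an error of \<open>e / 2^(i+1)\<close> and enumerate all covering sets
  by one index.
\<close>
lemma hausdorff1_pre_countably_subadditive:
  "hausdorff1_pre \<delta> (\<Union>i. A i) \<le> (\<Sum>i. hausdorff1_pre \<delta> (A i))"
proof (rule ennreal_le_epsilon)
  fix e :: real assume fin: "(\<Sum>i. hausdorff1_pre \<delta> (A i)) < top" and e: "0 < e"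
  have "\<exists>U. (\<forall>j. U j \<subseteq> S1 \<and> diam_S1 (U j) \<le> ennreal \<delta>) \<and> A i \<subseteq> (\<Union>j. U j) \<and>
      (\<Sum>j. diam_S1 (U j)) \<le> hausdorff1_pre \<delta> (A i) + ennreal (e * (1/2) ^ Suc i)" for i
  proof -
    have "hausdorff1_pre \<delta> (A i) \<noteq> \<infinity>"
      using ennreal_suminf_lessD[OF fin, of i] by simp
    from INF_approx_ennreal[OF _ hausdorff1_pre_def this, of "e * (1/2) ^ Suc i"] e
    show ?thesis by (auto intro: less_imp_le)
  qed
  then obtain U where U: "\<And>i j. U i j \<subseteq> S1" "\<And>i j. diam_S1 (U i j) \<le> ennreal \<delta>" "\<And>i. A i \<subseteq> (\<Union>j. U i j)"
    "\<And>i. (\<Sum>j. diam_S1 (U i j)) \<le> hausdorff1_pre \<delta> (A i) + ennreal (e * (1/2) ^ Suc i)"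
    by metis
  define W where "W k = (case prod_decode k of (i, j) \<Rightarrow> U i j)" for k
  have "hausdorff1_pre \<delta> (\<Union>i. A i) \<le> (\<Sum>k. diam_S1 (W k))"
  proof (rule hausdorff1_pre_le)
    show "(\<Union>i. A i) \<subseteq> (\<Union>k. W k)"
    proof
      fix x assume "x \<in> (\<Union>i. A i)"
      then obtain i j where "x \<in> U i j"
        using U(3) by blast
      then have "x \<in> W (prod_encode (i, j))"
        by (simp add: W_def)
      then show "x \<in> (\<Union>k. W k)" by blast
    qed
  qed (auto simp: W_def U split: prod.split dest: subsetD[OF U(1)])
  also have "\<dots> = (\<Sum>k. (\<lambda>(i, j). diam_S1 (U i j)) (prod_decode k))"
    by (simp add: W_def split_beta)
  also have "\<dots> = (\<Sum>i. \<Sum>j. diam_S1 (U i j))"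
    by (rule suminf_ennreal_2dimen) simp
  also have "\<dots> \<le> (\<Sum>i. hausdorff1_pre \<delta> (A i) + ennreal (e * (1/2) ^ Suc i))"
    by (intro suminf_le U) auto
  also have "\<dots> = (\<Sum>i. hausdorff1_pre \<delta> (A i)) + (\<Sum>i. ennreal (e * (1/2) ^ Suc i))"
    by (rule suminf_add[symmetric]) auto
  also have "(\<Sum>i. ennreal (e * (1/2) ^ Suc i)) = ennreal e"
    using sums_mult[OF power_half_series, of e] e by (intro suminf_ennreal_eq) auto
  finally show "hausdorff1_pre \<delta> (\<Union>i. A i) \<le> (\<Sum>i. hausdorff1_pre \<delta> (A i)) + ennreal e" .
qed

text \<open>
  An arc is cut into finitely many pieces of length at most \<open>\<delta>\<close>.
\<close>
lemma hausdorff1_pre_arc_le: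
  assumes "a \<le> b" "0 < \<delta>"
  shows "hausdorff1_pre \<delta> (q ` {a..b}) \<le> ennreal (b - a)"
proof -
  obtain n :: nat where n: "(b - a) / \<delta> < real n"
    using reals_Archimedean2 by blast
  then have npos: "0 < n"
    using assms by (intro gr0I) (auto simp: divide_less_0_iff)
  define h where "h = (b - a) / n"
  have h: "0 \<le> h" "h \<le> \<delta>" "n * h = b - a"
    using n npos assms by (auto simp: h_def field_simps)
  define U where "U i = (if i < n then q ` {a + real i * h..a + real (Suc i) * h} else {})" for i
  have diam: "diam_S1 (U i) \<le> ennreal (if i < n then h else 0)" for i
    using diam_S1_arc_le[of "a + real i * h" "a + real (Suc i) * h"] h
    by (auto simp: U_def algebra_simps)
  have "hausdorff1_pre \<delta> (q ` {a..b}) \<le> (\<Sum>i. diam_S1 (U i))"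
  proof (rule hausdorff1_pre_le)
    show "U i \<subseteq> S1" for i
      by (auto simp: U_def)
    show "diam_S1 (U i) \<le> ennreal \<delta>" for i
      using diam[of i] h assms by (auto elim!: order_trans intro!: ennreal_leI)
    show "q ` {a..b} \<subseteq> (\<Union>i. U i)"
    proof clarify
      fix t assume t: "t \<in> {a..b}"
      show "q t \<in> (\<Union>i. U i)"
      proof (cases "t = b")
        case True
        have "a + real (n - 1) * h \<le> b" "a + real (Suc (n - 1)) * h = b"
          using npos h by (auto simp: of_nat_diff algebra_simps)
        then have "q t \<in> U (n - 1)"
          using npos True unfolding U_def by (auto intro!: imageI)
        then show ?thesis by blast
      next
        case False
        then have "0 < b - a" using t by auto
        then have hpos: "0 < h" using npos by (simp add: h_def)
        define i where "i = nat \<lfloor>(t - a) / h\<rfloor>"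
        have "0 \<le> (t - a) / h" using t hpos by simp
        then have "real i \<le> (t - a) / h" "(t - a) / h < real i + 1"
          unfolding i_def by linarith+
        then have i: "real i * h \<le> t - a" "t - a < real (Suc i) * h"
          using hpos by (auto simp: field_simps)
        have "real i * h < n * h"
          using i(1) t False h(3) by auto
        then have "i < n"
          using hpos by simp
        then have "q t \<in> U i"
          using i unfolding U_def by (auto intro!: imageI)
        then show ?thesis by blast
      qed
    qed
  qed
  also have "\<dots> \<le> (\<Sum>i. ennreal (if i < n then h else 0))"
    by (intro suminf_le diam) auto
  also have "\<dots> = (\<Sum>i<n. ennreal (if i < n then h else 0))"
    by (intro suminf_finite) auto
  also have "\<dots> = ennreal (b - a)"
    using h by (simp add: ennreal_of_nat_eq_real_of_nat flip: ennreal_mult)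
  finally show ?thesis .
qed

text \<open>
  The Lebesgue measure of this set is the length of \<open>A\<close>; the half-open window counts each point once.
\<close>
definition angles :: "(real^2) set \<Rightarrow> real set" where
  "angles A = q -` A \<inter> {0..<2 * pi}"

lemma angles_borel:
  assumes "A \<in> sets borel"
  shows "angles A \<in> sets borel"
  using measurable_sets[OF borel_measurable_continuous_onI[OF continuous_on_q[of UNIV]] assms]
  by (auto simp: angles_def)

lemma angles_lmeasurable:
  assumes "A \<in> sets borel"
  shows "angles A \<in> lmeasurable"
proof (rule bounded_set_imp_lmeasurable)
  show "bounded (angles A)"
    by (rule bounded_subset[of "{0..2 * pi}"]) (auto simp: angles_def)
  show "angles A \<in> sets lebesgue"
    using angles_borel[OF assms] by auto
qed

lemma image_angles:
  assumes "A \<subseteq> S1"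
  shows "q ` angles A = A"
proof
  show "q ` angles A \<subseteq> A" by (auto simp: angles_def)
  show "A \<subseteq> q ` angles A"
  proof
    fix x assume "x \<in> A"
    moreover then obtain t where "x = q t" "0 \<le> t" "t < 0 + 2 * pi"
      using assms S1_lift[of x 0] by blast
    ultimately show "x \<in> q ` angles A"
      by (auto simp: angles_def)
  qed
qed

text \<open>
  The angles are covered by countably many non-overlapping intervals of almost the same total length,
  and each interval maps to an arc.
\<close>
lemma hausdorff1_pre_le_angles:
  assumes A: "A \<in> borel_S1" and \<delta>: "0 < \<delta>"
  shows "hausdorff1_pre \<delta> A \<le> ennreal (measure lebesgue (angles A))"
proof (rule ennreal_le_epsilon)
  fix e :: real assume e: "0 < e"
  have AS: "A \<in> sets borel" "A \<subseteq> S1"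
    using A by (auto simp: borel_S1_iff)
  have sub: "angles A \<subseteq> cbox 0 (2 * pi)"
    by (auto simp: angles_def)
  obtain \<D> where \<D>: "countable \<D>"
    "\<And>K. K \<in> \<D> \<Longrightarrow> K \<subseteq> cbox 0 (2 * pi) \<and> K \<noteq> {} \<and> (\<exists>c d. K = cbox c (d :: real))"
    "pairwise (\<lambda>A B. interior A \<inter> interior B = {}) \<D>"
    "angles A \<subseteq> \<Union>\<D>" "measure lebesgue (\<Union>\<D>) \<le> measure lebesgue (angles A) + e"
    using measurable_outer_intervals_bounded[OF angles_lmeasurable[OF AS(1)] sub e] by metis
  \<comment> \<open>An enumeration of the intervals without repetition, padded by empty sets if there are finitely many.\<close>
  define F where "F i = (if i \<in> to_nat_on \<D> ` \<D> then from_nat_into \<D> i else {})" for i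
  have F_cases: "F i = {} \<or> (F i \<in> \<D> \<and> to_nat_on \<D> (F i) = i)" for i
    using \<D>(1) by (auto simp: F_def)
  have UF: "(\<Union>i. F i) = \<Union>\<D>"
  proof
    show "(\<Union>i. F i) \<subseteq> \<Union>\<D>"
      using F_cases by blast
    show "\<Union>\<D> \<subseteq> (\<Union>i. F i)"
    proof
      fix x assume "x \<in> \<Union>\<D>"
      then obtain K where "K \<in> \<D>" "x \<in> K" by blast
      then have "x \<in> F (to_nat_on \<D> K)"
        using \<D>(1) by (simp add: F_def)
      then show "x \<in> (\<Union>i. F i)" by blast
    qed
  qed
  have F_interval: "\<exists>c d. F i = cbox c d" for i
    using F_cases[of i] \<D>(2)[of "F i"] empty_as_interval by metis
  have sums: "(\<lambda>i. measure lebesgue (F i)) sums measure lebesgue (\<Union>i. F i)"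
  proof (rule measure_countable_negligible_Union_bounded)
    show "F i \<in> lmeasurable" for i
      using F_interval[of i] by auto
    show "pairwise (\<lambda>m n. negligible (F m \<inter> F n)) UNIV"
    proof (rule pairwiseI)
      fix m n :: nat assume "m \<noteq> n"
      show "negligible (F m \<inter> F n)"
      proof (cases "F m = {} \<or> F n = {}")
        case False
        then have "F m \<in> \<D>" "F n \<in> \<D>" "F m \<noteq> F n"
          using F_cases[of m] F_cases[of n] \<open>m \<noteq> n\<close> by auto
        then have "interior (F m \<inter> F n) = {}"
          using \<D>(3) by (auto simp: pairwise_def)
        moreover have "convex (F m \<inter> F n)"
          using F_interval[of m] F_interval[of n] by (auto intro!: convex_Int)
        ultimately show ?thesis
          using negligible_convex_interior by blast
      qed auto
    qed
    have "\<Union>\<D> \<subseteq> cbox 0 (2 * pi)"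
      using \<D>(2) by blast
    then show "bounded (\<Union>i. F i)"
      unfolding UF using bounded_cbox bounded_subset by blast
  qed
  have "hausdorff1_pre \<delta> A \<le> hausdorff1_pre \<delta> (\<Union>i. q ` F i)"
  proof (rule hausdorff1_pre_mono)
    have "A = q ` angles A"
      by (rule image_angles[OF AS(2), symmetric])
    also have "\<dots> \<subseteq> q ` (\<Union>i. F i)"
      unfolding UF by (rule image_mono[OF \<D>(4)])
    finally show "A \<subseteq> (\<Union>i. q ` F i)"
      by (simp only: image_UN)
  qed
  also have "\<dots> \<le> (\<Sum>i. hausdorff1_pre \<delta> (q ` F i))"
    by (rule hausdorff1_pre_countably_subadditive)
  also have "\<dots> \<le> (\<Sum>i. ennreal (measure lebesgue (F i)))"
  proof (intro suminf_le)
    fix i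
    obtain c d where F: "F i = {c..d}"
      using F_interval[of i] by auto
    show "hausdorff1_pre \<delta> (q ` F i) \<le> ennreal (measure lebesgue (F i))"
    proof (cases "c \<le> d")
      case True
      then show ?thesis
        using hausdorff1_pre_arc_le[OF True \<delta>] F by simp
    next
      case False
      have "hausdorff1_pre \<delta> {} \<le> (\<Sum>i. diam_S1 {})"
        by (rule hausdorff1_pre_le) auto
      then show ?thesis
        using False F by simp
    qed
  qed auto
  also have "\<dots> = ennreal (measure lebesgue (\<Union>\<D>))"
    using sums unfolding UF by (intro suminf_ennreal_eq) auto
  also have "\<dots> \<le> ennreal (measure lebesgue (angles A) + e)"
    using \<D>(5) by (rule ennreal_leI)
  finally show "hausdorff1_pre \<delta> A \<le> ennreal (measure lebesgue (angles A)) + ennreal e"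
    using e by simp
qed

lemma q_add_cong: "q a = q b \<Longrightarrow> q (a + r) = q (b + r)"
  by (simp add: q_eq_iff_cos_sin cos_add sin_add)

text \<open>
  A set of small diameter lies in the half circle around any of its points. There angles are
  isometric coordinates, so the angles lie in an interval whose length is the diameter of the set,
  without loss of a constant factor.
\<close>
lemma small_set_in_arc:
  assumes U: "U \<subseteq> S1" "U \<noteq> {}" "diam_S1 U \<le> ennreal \<delta>" and \<delta>: "0 \<le> \<delta>" "\<delta> \<le> pi / 2"
  obtains a d where "0 \<le> a" "a < 2 * pi" "0 \<le> d" "d \<le> \<delta>" "diam_S1 U = ennreal d" "U \<subseteq> q ` {a..a + d}"
proof -
  obtain d where d: "0 \<le> d" "diam_S1 U = ennreal d"
    using U(3) by (cases "diam_S1 U" rule: ennreal_cases) (auto simp: top_unique)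
  have d\<delta>: "d \<le> \<delta>"
    using U(3) d \<delta> by simp
  have dist: "dS1 x y \<le> d" if "x \<in> U" "y \<in> U" for x y
    using dS1_le_diam_S1[OF that] d by simp
  obtain t0 where t0: "q t0 \<in> U"
    using U S1_lift by blast
  define P where "P = {s. \<bar>s\<bar> \<le> \<delta> \<and> q (t0 + s) \<in> U}"
  have P0: "0 \<in> P"
    using t0 \<delta> by (simp add: P_def)
  have Pbd: "bdd_below P"
    by (rule bdd_belowI[of _ "- \<delta>"]) (auto simp: P_def)
  have Pdist: "s - s' \<le> d" if "s \<in> P" "s' \<in> P" for s s'
    using dist[of "q (t0 + s)" "q (t0 + s')"] dS1_q_eq[of "t0 + s" "t0 + s'"] that \<delta>
    by (auto simp: P_def)
  \<comment> \<open>The least angle of the set; the next step only moves it into the window from 0 to 2 pi.\<close>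
  define a' where "a' = t0 + Inf P"
  obtain a where a: "q a' = q a" "0 \<le> a" "a < 0 + 2 * pi"
    using S1_lift[of "q a'" 0] by auto
  have "U \<subseteq> q ` {a..a + d}"
  proof
    fix x assume x: "x \<in> U"
    then obtain t where t: "x = q t" "t0 - pi \<le> t" "t < t0 - pi + 2 * pi"
      using S1_lift[of x "t0 - pi"] U by blast
    have "\<bar>t - t0\<bar> \<le> d"
      using dist[OF x t0] dS1_q_eq[of t t0] t by auto
    then have tP: "t - t0 \<in> P"
      using x t d\<delta> by (simp add: P_def)
    have "Inf P \<le> t - t0"
      by (rule cInf_lower[OF tP Pbd])
    moreover have "t - t0 - d \<le> Inf P"
      using Pdist[OF tP] P0 by (intro cInf_greatest) (auto simp: algebra_simps)
    ultimately have r: "0 \<le> t - a'" "t - a' \<le> d"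
      by (auto simp: a'_def)
    have "x = q (a + (t - a'))"
      using q_add_cong[OF a(1), of "t - a'"] t(1) by simp
    then show "x \<in> q ` {a..a + d}"
      using r by auto
  qed
  then show ?thesis
    using that d d\<delta> a by auto
qed

text \<open>
  An arc that passes the angle \<open>2\<pi>\<close> has two intervals of angles, with total length \<open>d\<close>.
\<close>
lemma angles_arc_le:
  assumes "0 \<le> a" "a < 2 * pi" "0 \<le> d" "d < 2 * pi"
  shows "emeasure lborel (angles (q ` {a..a + d})) \<le> ennreal d"
proof -
  have "angles (q ` {a..a + d}) \<subseteq> {a..min (a + d) (2 * pi)} \<union> {0..a + d - 2 * pi}"
  proof
    fix t assume "t \<in> angles (q ` {a..a + d})"
    then obtain s where s: "0 \<le> t" "t < 2 * pi" "q t = q s" "a \<le> s" "s \<le> a + d"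
      by (auto simp: angles_def)
    show "t \<in> {a..min (a + d) (2 * pi)} \<union> {0..a + d - 2 * pi}"
    proof (cases "s < 2 * pi")
      case True
      then have "t = s"
        using s assms by (intro q_eq_imp_eq) auto
      then show ?thesis using s by auto
    next
      case False
      have "t = s - 2 * pi"
        using s assms False q_plus_2pi[of "s - 2 * pi"] by (intro q_eq_imp_eq) auto
      then show ?thesis using s by auto
    qed
  qed
  then have "emeasure lborel (angles (q ` {a..a + d})) \<le> emeasure lborel ({a..min (a + d) (2 * pi)} \<union> {0..a + d - 2 * pi})"
    by (rule emeasure_mono) simp
  also have "\<dots> \<le> emeasure lborel {a..min (a + d) (2 * pi)} + emeasure lborel {0..a + d - 2 * pi}"
    by (rule emeasure_subadditive) auto
  also have "\<dots> = ennreal d"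
    using assms by (auto simp: emeasure_lborel_Icc_eq min_def simp flip: ennreal_plus)
  finally show ?thesis .
qed

text \<open>
  At scale \<open>1 \<le> \<pi> / 2\<close> every covering set lies in an arc whose length is its diameter, so the claim
  is the countable subadditivity of the Lebesgue measure.
\<close>
lemma angles_le_hausdorff1_pre:
  assumes A: "A \<in> borel_S1"
  shows "emeasure lborel (angles A) \<le> hausdorff1_pre 1 A"
  unfolding hausdorff1_pre_def
proof (rule INF_greatest, clarify)
  fix U :: "nat \<Rightarrow> (real^2) set"
  assume U: "\<forall>i. U i \<subseteq> S1 \<and> diam_S1 (U i) \<le> ennreal 1" "A \<subseteq> (\<Union>i. U i)"
  have pi2: "1 \<le> pi / 2"
    using pi_ge_two by simp
  have "\<exists>V. V \<in> sets borel \<and> U i \<subseteq> V \<and> emeasure lborel (angles V) \<le> diam_S1 (U i)" for i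
  proof (cases "U i = {}")
    case True
    then show ?thesis
      by (intro exI[of _ "{}"]) (auto simp: angles_def)
  next
    case False
    obtain a d where *: "0 \<le> a" "a < 2 * pi" "0 \<le> d" "d \<le> 1" "diam_S1 (U i) = ennreal d" "U i \<subseteq> q ` {a..a + d}"
      using small_set_in_arc[OF _ False, of 1] U(1) pi2 by auto
    have "closed (q ` {a..a + d})"
      by (intro compact_imp_closed compact_continuous_image continuous_on_q) simp
    then show ?thesis
      using * angles_arc_le[of a d] pi_ge_two by (intro exI[of _ "q ` {a..a + d}"]) (auto intro: borel_closed)
  qed
  then obtain V where V: "\<And>i. V i \<in> sets borel" "\<And>i. U i \<subseteq> V i" "\<And>i. emeasure lborel (angles (V i)) \<le> diam_S1 (U i)"
    by metis
  have "angles A \<subseteq> (\<Union>i. angles (V i))"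
    using U(2) V(2) by (fastforce simp: angles_def)
  then have "emeasure lborel (angles A) \<le> emeasure lborel (\<Union>i. angles (V i))"
    using angles_borel V by (intro emeasure_mono) auto
  also have "\<dots> \<le> (\<Sum>i. emeasure lborel (angles (V i)))"
    using angles_borel V by (intro emeasure_subadditive_countably) auto
  also have "\<dots> \<le> (\<Sum>i. diam_S1 (U i))"
    by (intro suminf_le V) auto
  finally show "emeasure lborel (angles A) \<le> (\<Sum>i. diam_S1 (U i))" .
qed

lemma hausdorff1_eq:
  assumes A: "A \<in> borel_S1"
  shows "hausdorff1 A = ennreal (measure lebesgue (angles A))"
proof (rule antisym)
  have AS: "A \<in> sets borel"
    using A by (auto simp: borel_S1_iff)
  show "hausdorff1 A \<le> ennreal (measure lebesgue (angles A))"
    unfolding hausdorff1_def using hausdorff1_pre_le_angles[OF A] by (intro SUP_least) auto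
  have "emeasure lborel (angles A) = emeasure lebesgue (angles A)"
    using angles_borel[OF AS] by simp
  also have "\<dots> = ennreal (measure lebesgue (angles A))"
    using angles_lmeasurable[OF AS] by (simp add: emeasure_eq_measure2)
  finally have "ennreal (measure lebesgue (angles A)) \<le> hausdorff1_pre 1 A"
    using angles_le_hausdorff1_pre[OF A] by simp
  also have "\<dots> \<le> hausdorff1 A"
    unfolding hausdorff1_def by (rule SUP_upper) auto
  finally show "ennreal (measure lebesgue (angles A)) \<le> hausdorff1 A" .
qed

text \<open>
  By convention \<^const>\<open>measure_of\<close> returns the zero measure when the given set function is not a
  measure. The values of \<^const>\<open>normalized_H1\<close> are therefore available only after this set function has
  been recognised as that of an existing measure, here the length of the angles.
\<close>
lemma normalized_H1_measure:
  shows "finite_borel_S1 normalized_H1"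
    and "A \<in> borel_S1 \<Longrightarrow> measure normalized_H1 A = measure lebesgue (angles A) / (2 * pi)"
proof -
  have "\<exists>\<mu>. finite_borel_S1 \<mu> \<and> (\<forall>A\<in>borel_S1. measure \<mu> A = measure lebesgue (angles A) / (2 * pi))"
  proof (rule finite_borel_S1_exists)
    fix A :: "nat \<Rightarrow> (real^2) set"
    assume A: "range A \<subseteq> borel_S1" "disjoint_family A"
    then have meas: "A i \<in> sets borel" for i
      by (auto simp: borel_S1_iff image_subset_iff)
    have "(\<lambda>i. measure lebesgue (angles (A i))) sums measure lebesgue (\<Union>i. angles (A i))"
    proof (rule measure_countable_negligible_Union_bounded)
      show "angles (A i) \<in> lmeasurable" for i
        using meas by (rule angles_lmeasurable)
      have "angles (A m) \<inter> angles (A n) = {}" if "m \<noteq> n" for m n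
        using A(2) that by (auto simp: disjoint_family_on_def angles_def)
      then show "pairwise (\<lambda>m n. negligible (angles (A m) \<inter> angles (A n))) UNIV"
        by (auto simp: pairwise_def)
      show "bounded (\<Union>i. angles (A i))"
        by (rule bounded_subset[of "{0..2 * pi}"]) (auto simp: angles_def)
    qed
    moreover have "(\<Union>i. angles (A i)) = angles (\<Union>i. A i)"
      by (auto simp: angles_def)
    ultimately show "(\<lambda>i. measure lebesgue (angles (A i)) / (2 * pi)) sums (measure lebesgue (angles (\<Union>i. A i)) / (2 * pi))"
      using sums_divide by metis
  qed simp
  then obtain \<mu> where \<mu>: "finite_borel_S1 \<mu>" "\<And>A. A \<in> borel_S1 \<Longrightarrow> measure \<mu> A = measure lebesgue (angles A) / (2 * pi)"
    by blast
  interpret finite_measure \<mu>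
    using \<mu>(1) by (rule finite_borel_S1D)
  note \<mu>_sets = finite_borel_S1D[OF \<mu>(1)]
  have full: "hausdorff1 S1 = ennreal (2 * pi)"
  proof -
    have "angles S1 = {0..<2 * pi}"
      by (auto simp: angles_def)
    then show ?thesis
      by (simp add: hausdorff1_eq)
  qed
  have "normalized_H1 = measure_of S1 borel_S1 (emeasure \<mu>)"
    unfolding normalized_H1_def
  proof (rule measure_of_eq)
    show "borel_S1 \<subseteq> Pow S1"
      by (auto simp: borel_S1_iff)
    fix A assume "A \<in> sigma_sets S1 borel_S1"
    then have A: "A \<in> borel_S1"
      using sets.sigma_sets_eq[of \<mu>] \<mu>_sets by simp
    show "hausdorff1 A / hausdorff1 S1 = emeasure \<mu> A"
      unfolding full hausdorff1_eq[OF A] emeasure_eq_measure \<mu>(2)[OF A] by (rule divide_ennreal) auto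
  qed
  also have "\<dots> = \<mu>"
    using measure_of_of_measure[of \<mu>] \<mu>_sets by simp
  finally have eq: "normalized_H1 = \<mu>" .
  show "finite_borel_S1 normalized_H1"
    unfolding eq by (rule \<mu>(1))
  show "A \<in> borel_S1 \<Longrightarrow> measure normalized_H1 A = measure lebesgue (angles A) / (2 * pi)"
    unfolding eq by (rule \<mu>(2))
qed

lemma normalized_H1_S1: "measure normalized_H1 S1 = 1"
proof -
  have "angles S1 = {0..<2 * pi}"
    by (auto simp: angles_def)
  then show ?thesis
    by (simp add: normalized_H1_measure)
qed

text \<open>
  The antipodal map is an isometry, so it maps covers to covers of the same diameters.
\<close>
lemma hausdorff1_uminus: "hausdorff1 (uminus ` A) = hausdorff1 A"
proof -
  have diam: "diam_S1 (uminus ` U) = diam_S1 U" for U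
    by (simp add: diam_S1_def image_image dS1_def)
  have le: "hausdorff1_pre \<delta> (uminus ` A) \<le> hausdorff1_pre \<delta> A" for \<delta> A
    unfolding hausdorff1_pre_def[of \<delta> A]
  proof (rule INF_greatest, clarify)
    fix U :: "nat \<Rightarrow> (real^2) set"
    assume U: "\<forall>i. U i \<subseteq> S1 \<and> diam_S1 (U i) \<le> ennreal \<delta>" "A \<subseteq> (\<Union>i. U i)"
    have "hausdorff1_pre \<delta> (uminus ` A) \<le> (\<Sum>i. diam_S1 (uminus ` U i))"
    proof (rule hausdorff1_pre_le)
      show "uminus ` U i \<subseteq> S1" for i
      proof -
        have "U i \<subseteq> S1" using U(1) by blast
        then show ?thesis by auto
      qed
      show "diam_S1 (uminus ` U i) \<le> ennreal \<delta>" for i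
        using U(1) by (simp add: diam)
      show "uminus ` A \<subseteq> (\<Union>i. uminus ` U i)"
        using U(2) by (simp only: image_UN[symmetric] image_mono)
    qed
    then show "hausdorff1_pre \<delta> (uminus ` A) \<le> (\<Sum>i. diam_S1 (U i))"
      by (simp add: diam)
  qed
  have "hausdorff1_pre \<delta> (uminus ` A) = hausdorff1_pre \<delta> A" for \<delta>
    using le[of \<delta> A] le[of \<delta> "uminus ` A"] by (simp add: image_image)
  then show ?thesis
    by (simp add: hausdorff1_def)
qed

lemma normalized_H1_uminus:
  assumes "A \<in> borel_S1"
  shows "measure normalized_H1 (uminus ` A) = measure normalized_H1 A"
  using hausdorff1_uminus[of A] assms uminus_borel_S1[OF assms]
  by (simp add: normalized_H1_measure hausdorff1_eq)

section \<open>Functions with a given left derivative\<close>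

lemma left_derivative_iff:
  fixes \<phi> :: "real \<Rightarrow> real"
  shows "(\<phi> has_real_derivative l) (at_left t) \<longleftrightarrow> ((\<lambda>s. (\<phi> (t + s) - \<phi> t) / s) \<longlongrightarrow> l) (at_left 0)"
proof -
  have "x \<in> (+) t ` {..<0}" if "x < t" for x
    using that by (intro image_eqI[of _ _ "x - t"]) auto
  then have "(+) t ` {..<0} = {..<t}"
    by auto
  then have "(\<phi> has_real_derivative l) (at_left t) \<longleftrightarrow> ((\<lambda>s. \<phi> (t + s)) has_real_derivative l) (at_left 0)"
    using DERIV_at_within_shift[of \<phi> l t 0 "{..<0}"] by simp
  then show ?thesis
    by (simp add: has_field_derivative_iff)
qed

text \<open>
  A mean value inequality for one-sided derivatives. For a slope \<open>M + e\<close>, consider the points \<open>t\<close> from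
  which the increment up to \<open>b\<close> obeys the bound. If their infimum were not \<open>a\<close>, then the left derivative
  at the infimum would yield a smaller point of this kind.
\<close>
lemma left_derivative_le_imp_increment_le_closed:
  fixes \<phi> :: "real \<Rightarrow> real"
  assumes ab: "a \<le> b" and cont: "continuous_on {a..b} \<phi>"
    and der: "\<And>t. a < t \<Longrightarrow> t \<le> b \<Longrightarrow> \<exists>l\<le>M. (\<phi> has_real_derivative l) (at_left t)"
  shows "\<phi> b - \<phi> a \<le> M * (b - a)"
proof (rule field_le_epsilon)
  fix e' :: real assume e': "0 < e'"
  \<comment> \<open>The summand 1 keeps the denominator positive when the interval is degenerate.\<close>
  define e where "e = e' / (b - a + 1)"
  have e: "0 < e" "e * (b - a) \<le> e'"
    using e' ab by (auto simp: e_def field_simps)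
  define S where "S = {t \<in> {a..b}. \<phi> b - \<phi> t \<le> (M + e) * (b - t)}"
  have S: "b \<in> S" "bdd_below S"
    using ab by (auto simp: S_def)
  have "closed S"
    unfolding S_def using cont by (intro continuous_on_closed_Collect_le continuous_intros) auto
  then have m: "Inf S \<in> S"
    using S by (intro closed_contains_Inf) auto
  have "Inf S = a"
  proof (rule ccontr)
    assume "Inf S \<noteq> a"
    then have am: "a < Inf S" "Inf S \<le> b"
      using m by (auto simp: S_def)
    then obtain l where l: "l \<le> M" "(\<phi> has_real_derivative l) (at_left (Inf S))"
      using der by blast
    have "eventually (\<lambda>s. (\<phi> (Inf S + s) - \<phi> (Inf S)) / s < M + e) (at_left 0)"
      using l e by (intro order_tendstoD(2)[OF iffD1[OF left_derivative_iff l(2)]]) auto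
    moreover have "eventually (\<lambda>s. a - Inf S < s) (at_left 0)"
      using am by (intro eventually_at_leftI[of "a - Inf S"]) auto
    moreover have "eventually (\<lambda>s::real. s < 0) (at_left 0)"
      by (intro eventually_at_leftI[of "- 1"]) auto
    ultimately have "eventually (\<lambda>s. (\<phi> (Inf S + s) - \<phi> (Inf S)) / s < M + e \<and> a - Inf S < s \<and> s < 0) (at_left 0)"
      by eventually_elim auto
    then obtain s where s: "(\<phi> (Inf S + s) - \<phi> (Inf S)) / s < M + e" "a - Inf S < s" "s < 0"
      using eventually_happens by force
    have "\<phi> (Inf S) - \<phi> (Inf S + s) < (M + e) * (- s)"
      using s by (simp add: divide_less_eq algebra_simps)
    moreover have "\<phi> b - \<phi> (Inf S) \<le> (M + e) * (b - Inf S)"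
      using m by (simp add: S_def)
    ultimately have "\<phi> b - \<phi> (Inf S + s) \<le> (M + e) * (b - Inf S) + (M + e) * (- s)"
      by linarith
    then have "Inf S + s \<in> S"
      using s am by (auto simp: S_def algebra_simps)
    then have "Inf S \<le> Inf S + s"
      using S(2) by (rule cInf_lower)
    then show False using s by simp
  qed
  then have "\<phi> b - \<phi> a \<le> (M + e) * (b - a)"
    using m by (simp add: S_def)
  then show "\<phi> b - \<phi> a \<le> M * (b - a) + e'"
    using e(2) by (simp add: distrib_right)
qed

lemma left_derivative_le_imp_increment_le:
  fixes \<phi> :: "real \<Rightarrow> real"
  assumes ab: "a < b" and cont: "continuous_on {a..b} \<phi>"
    and der: "\<And>t. a < t \<Longrightarrow> t < b \<Longrightarrow> \<exists>l\<le>M. (\<phi> has_real_derivative l) (at_left t)"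
  shows "\<phi> b - \<phi> a \<le> M * (b - a)"
proof (rule tendsto_le[OF trivial_limit_at_left_real])
  have "((\<lambda>t. \<phi> t) \<longlongrightarrow> \<phi> b) (at_left b)"
    using continuous_on_Icc_at_leftD[OF cont ab] .
  then show "((\<lambda>t. \<phi> t - \<phi> a) \<longlongrightarrow> \<phi> b - \<phi> a) (at_left b)"
    by (intro tendsto_intros)
  show "((\<lambda>t. M * (t - a)) \<longlongrightarrow> M * (b - a)) (at_left b)"
    by (intro tendsto_intros)
  show "eventually (\<lambda>t. \<phi> t - \<phi> a \<le> M * (t - a)) (at_left b)"
  proof (rule eventually_at_leftI[OF _ ab])
    fix t assume "t \<in> {a<..<b}"
    then show "\<phi> t - \<phi> a \<le> M * (t - a)"
      using der by (intro left_derivative_le_imp_increment_le_closed continuous_on_subset[OF cont]) auto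
  qed
qed

lemma left_derivative_zero_imp_constant:
  fixes \<phi> :: "real \<Rightarrow> real"
  assumes "continuous_on UNIV \<phi>" "\<And>t. (\<phi> has_real_derivative 0) (at_left t)"
  shows "\<phi> a = \<phi> b"
proof -
  have "\<phi> b = \<phi> a" if "a < b" for a b
  proof -
    have "\<phi> b - \<phi> a \<le> 0 * (b - a)"
      using assms by (intro left_derivative_le_imp_increment_le that continuous_on_subset[OF assms(1)]) auto
    moreover have "(- \<phi> b) - (- \<phi> a) \<le> 0 * (b - a)"
    proof (rule left_derivative_le_imp_increment_le[OF that])
      show "continuous_on {a..b} (\<lambda>t. - \<phi> t)"
        using assms(1) by (intro continuous_intros continuous_on_subset[OF assms(1)]) auto
      show "\<exists>l\<le>0. ((\<lambda>t. - \<phi> t) has_real_derivative l) (at_left t)" for t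
        using DERIV_minus[OF assms(2)[of t]] by (intro exI[of _ 0]) simp
    qed
    ultimately show ?thesis by simp
  qed
  then show ?thesis
    using linorder_less_linear[of a b] by auto
qed

text \<open>
  A one-sided derivative inherits one-sided limits: close to \<open>b\<close> on the left, the mean value inequality
  squeezes all slopes of chords ending in \<open>b\<close> between \<open>L - e\<close> and \<open>L + e\<close>.
\<close>
lemma left_derivative_left_continuous:
  fixes \<phi> h :: "real \<Rightarrow> real"
  assumes cont: "continuous_on UNIV \<phi>" and der: "\<And>t. (\<phi> has_real_derivative h t) (at_left t)"
    and lim: "(h \<longlongrightarrow> L) (at_left b)"
  shows "h b = L"
proof -
  have upper: "h b \<le> L"
    if cont: "continuous_on UNIV \<phi>" and der: "\<And>t. (\<phi> has_real_derivative h t) (at_left t)"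
      and lim: "(h \<longlongrightarrow> L) (at_left b)" for \<phi> h :: "real \<Rightarrow> real" and L
  proof (rule field_le_epsilon)
    fix e :: real assume "0 < e"
    then have "eventually (\<lambda>t. h t < L + e) (at_left b)"
      by (intro order_tendstoD(2)[OF lim]) auto
    then obtain c where c: "c < b" "\<And>t. c < t \<Longrightarrow> t < b \<Longrightarrow> h t < L + e"
      unfolding eventually_at_left_field by blast
    show "h b \<le> L + e"
    proof (rule tendsto_upperbound[OF iffD1[OF left_derivative_iff der[of b]]])
      show "eventually (\<lambda>s. (\<phi> (b + s) - \<phi> b) / s \<le> L + e) (at_left 0)"
      proof (rule eventually_at_leftI[of "c - b"])
        fix s assume s: "s \<in> {c - b<..<0}"
        have "\<phi> b - \<phi> (b + s) \<le> (L + e) * (b - (b + s))"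
        proof (rule left_derivative_le_imp_increment_le)
          show "\<exists>l\<le>L + e. (\<phi> has_real_derivative l) (at_left t)" if "b + s < t" "t < b" for t
            using c(2)[of t] der[of t] that s by (intro exI[of _ "h t"]) auto
        qed (use s in \<open>auto intro: continuous_on_subset[OF cont]\<close>)
        then show "(\<phi> (b + s) - \<phi> b) / s \<le> L + e"
          using s by (simp add: divide_le_eq algebra_simps)
      qed (use c in simp)
    qed simp
  qed
  have "- h b \<le> - L"
  proof (rule upper)
    show "continuous_on UNIV (\<lambda>t. - \<phi> t)"
      using cont by (intro continuous_intros)
    show "((\<lambda>t. - \<phi> t) has_real_derivative - h t) (at_left t)" for t
      by (rule DERIV_minus[OF der])
    show "((\<lambda>t. - h t) \<longlongrightarrow> - L) (at_left b)"
      using lim by (intro tendsto_intros)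
  qed
  moreover have "h b \<le> L"
    by (rule upper[OF cont der lim])
  ultimately show ?thesis by simp
qed

section \<open>Jordan decomposition\<close>

definition variation_sums :: "(real \<Rightarrow> real) \<Rightarrow> real \<Rightarrow> real set" where
  "variation_sums h t = {\<Sum>i=0..n. \<bar>h (x i) - h (x (Suc i))\<bar> | n x.
     x 0 = 0 \<and> x (Suc n) = t \<and> (\<forall>i\<le>n. x i \<le> x (Suc i))}"

lemma variation_sums_trivial:
  assumes "0 \<le> t"
  shows "\<bar>h 0 - h t\<bar> \<in> variation_sums h t"
  unfolding variation_sums_def using assms
  by (intro CollectI exI[of _ 0] exI[of _ "\<lambda>i. if i = 0 then 0 else t"]) auto

lemma variation_sums_extend:
  assumes "v \<in> variation_sums h s" "s \<le> t"
  shows "v + \<bar>h s - h t\<bar> \<in> variation_sums h t"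
proof -
  obtain n x where x: "v = (\<Sum>i=0..n. \<bar>h (x i) - h (x (Suc i))\<bar>)"
    "x 0 = 0" "x (Suc n) = s" "\<forall>i\<le>n. x i \<le> x (Suc i)"
    using assms(1) by (auto simp: variation_sums_def)
  define y where "y i = (if i \<le> Suc n then x i else t)" for i
  have "(\<Sum>i=0..n. \<bar>h (y i) - h (y (Suc i))\<bar>) = v"
    unfolding x(1) by (rule sum.cong) (auto simp: y_def)
  then have "v + \<bar>h s - h t\<bar> = (\<Sum>i=0..Suc n. \<bar>h (y i) - h (y (Suc i))\<bar>)"
    by (simp add: y_def x(3))
  moreover have "y 0 = 0" "y (Suc (Suc n)) = t" "\<forall>i\<le>Suc n. y i \<le> y (Suc i)"
    using x assms(2) by (auto simp: y_def le_Suc_eq)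
  ultimately show ?thesis
    unfolding variation_sums_def by blast
qed

text \<open>
  With \<open>V t\<close> the variation on \<open>[0, t]\<close>, take \<open>(V \<plusminus> (h - h 0)) / 2\<close>. Superadditivity of the variation,
  \<open>V s + \<bar>h s - h t\<bar> \<le> V t\<close>, is all that monotonicity requires.
\<close>
lemma jordan_decomposition:
  fixes h :: "real \<Rightarrow> real"
  assumes bound: "\<And>v. v \<in> variation_sums h c \<Longrightarrow> v \<le> T"
  obtains p n where "mono_on {0..c} p" "mono_on {0..c} n"
    "\<And>t. t \<in> {0..c} \<Longrightarrow> 0 \<le> p t" "\<And>t. t \<in> {0..c} \<Longrightarrow> 0 \<le> n t"
    "\<And>t. t \<in> {0..c} \<Longrightarrow> p t + n t \<le> T" "\<And>t. h t = h 0 + p t - n t"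
proof -
  define V where "V t = Sup (variation_sums h t)" for t
  have le_T: "v \<le> T" if "v \<in> variation_sums h t" "t \<in> {0..c}" for v t
    using bound[OF variation_sums_extend[OF that(1)]] that(2) by fastforce
  have bdd: "bdd_above (variation_sums h t)" if "t \<in> {0..c}" for t
    using le_T[OF _ that] by (auto simp: bdd_above_def)
  have ne: "variation_sums h t \<noteq> {}" if "t \<in> {0..c}" for t
    using variation_sums_trivial[of t h] that by auto
  have V_le: "V t \<le> T" if "t \<in> {0..c}" for t
    unfolding V_def using ne le_T that by (intro cSup_least) auto
  have V_ge: "\<bar>h 0 - h t\<bar> \<le> V t" if "t \<in> {0..c}" for t
    unfolding V_def using variation_sums_trivial bdd that by (intro cSup_upper) auto
  have V_inc: "V s + \<bar>h s - h t\<bar> \<le> V t" if "s \<in> {0..c}" "t \<in> {0..c}" "s \<le> t" for s t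
  proof -
    have "V s \<le> V t - \<bar>h s - h t\<bar>"
      unfolding V_def[of s]
    proof (rule cSup_least[OF ne[OF that(1)]])
      fix v assume "v \<in> variation_sums h s"
      then have "v + \<bar>h s - h t\<bar> \<in> variation_sums h t"
        using that(3) by (rule variation_sums_extend)
      then have "v + \<bar>h s - h t\<bar> \<le> V t"
        unfolding V_def using bdd[OF that(2)] by (rule cSup_upper)
      then show "v \<le> V t - \<bar>h s - h t\<bar>" by simp
    qed
    then show ?thesis by simp
  qed
  show ?thesis
  proof
    show "mono_on {0..c} (\<lambda>t. (V t + h t - h 0) / 2)" "mono_on {0..c} (\<lambda>t. (V t - h t + h 0) / 2)"
      using V_inc by (auto intro!: mono_onI simp: abs_le_iff) (smt (verit) V_inc atLeastAtMost_iff)+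
    show "t \<in> {0..c} \<Longrightarrow> 0 \<le> (V t + h t - h 0) / 2" "t \<in> {0..c} \<Longrightarrow> 0 \<le> (V t - h t + h 0) / 2" for t
      using V_ge[of t] by auto
    show "t \<in> {0..c} \<Longrightarrow> (V t + h t - h 0) / 2 + (V t - h t + h 0) / 2 \<le> T" for t
      using V_le[of t] by (simp add: field_simps)
    show "h t = h 0 + (V t + h t - h 0) / 2 - (V t - h t + h 0) / 2" for t
      by (simp add: field_simps)
  qed
qed

lemma mono_on_tendsto_left:
  fixes p :: "real \<Rightarrow> real"
  assumes p: "mono_on {0..c} p" and b: "0 < b" "b \<le> c"
  shows "(p \<longlongrightarrow> Sup (p ` {0..<b})) (at_left b)"
proof -
  have bdd: "bdd_above (p ` {0..<b})"
    using p b by (intro bdd_aboveI[of _ "p b"]) (auto simp: mono_on_def)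
  show ?thesis
  proof (rule order_tendstoI)
    fix a assume "a < Sup (p ` {0..<b})"
    then obtain t where t: "0 \<le> t" "t < b" "a < p t"
      using less_cSup_iff[OF _ bdd, of a] b by auto
    show "eventually (\<lambda>s. a < p s) (at_left b)"
    proof (rule eventually_at_leftI[of t])
      fix s assume "s \<in> {t<..<b}"
      then have "p t \<le> p s"
        using t b by (intro mono_onD[OF p]) auto
      then show "a < p s" using t by simp
    qed (use t in simp)
  next
    fix a assume a: "Sup (p ` {0..<b}) < a"
    show "eventually (\<lambda>s. p s < a) (at_left b)"
    proof (rule eventually_at_leftI[of 0])
      fix s assume "s \<in> {0<..<b}"
      then have "p s \<le> Sup (p ` {0..<b})"
        by (intro cSup_upper bdd) auto
      then show "p s < a" using a by simp
    qed (use b in simp)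
  qed
qed

section \<open>The measure of a monotone function\<close>

text \<open>
  The measure is the image of the Lebesgue measure on \<open>[0, m)\<close> under \<open>q \<circ> Q\<close>, where \<open>Q\<close> is the
  generalised inverse of \<open>p\<close>. It satisfies \<open>Q y < b\<close> iff \<open>y\<close> lies below the left limit of \<open>p\<close> at \<open>b\<close>,
  so that the mass of the arc \<open>[0, b)\<close> is this left limit. In particular the value \<open>p 0\<close> contributes mass
  at the angle \<open>0\<close>.
\<close>
lemma measure_of_mono_on:
  fixes p :: "real \<Rightarrow> real"
  assumes p: "mono_on {0..2 * pi} p" and nonneg: "\<And>t. t \<in> {0..2 * pi} \<Longrightarrow> 0 \<le> p t"
  obtains P where "finite_borel_S1 P"
    "\<And>b. 0 < b \<Longrightarrow> b \<le> 2 * pi \<Longrightarrow> measure P (circ_arc 0 b) = Sup (p ` {0..<b})"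
proof -
  define m where "m = Sup (p ` {0..<2 * pi})"
  \<comment> \<open>The generalised inverse: the first angle from which the function exceeds the level y.\<close>
  define R where "R y = {t \<in> {0..<2 * pi}. y < p t}" for y
  define Q where "Q y = Inf (R y)" for y
  have bdd: "bdd_above (p ` {0..<b})" if "b \<le> 2 * pi" for b
    using p that by (intro bdd_aboveI[of _ "p (2 * pi)"]) (auto simp: mono_on_def)
  have R_bdd: "bdd_below (R y)" for y
    by (rule bdd_belowI[of _ 0]) (auto simp: R_def)
  have R_ne: "R y \<noteq> {}" if "y < m" for y
    using that less_cSup_iff[OF _ bdd, of "2 * pi" y] by (auto simp: R_def m_def)
  have Q_less: "Q y < b \<longleftrightarrow> y < Sup (p ` {0..<b})" if "y < m" "0 < b" "b \<le> 2 * pi" for y b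
  proof -
    have "Q y < b \<longleftrightarrow> (\<exists>t\<in>R y. t < b)"
      unfolding Q_def by (rule cInf_less_iff[OF R_ne[OF that(1)] R_bdd])
    also have "\<dots> \<longleftrightarrow> (\<exists>t\<in>{0..<b}. y < p t)"
      using that(3) by (auto simp: R_def)
    also have "\<dots> \<longleftrightarrow> y < Sup (p ` {0..<b})"
      using less_cSup_iff[OF _ bdd[OF that(3)], of y] that(2) by auto
    finally show ?thesis .
  qed
  have Q_range: "0 \<le> Q y" "Q y < 2 * pi" if "y < m" for y
  proof -
    show "0 \<le> Q y"
      unfolding Q_def using R_ne[OF that] by (intro cInf_greatest) (auto simp: R_def)
    show "Q y < 2 * pi"
      using Q_less[OF that, of "2 * pi"] that by (simp add: m_def)
  qed
  let ?L = "restrict_space lborel {0..<m}"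
  have "mono_on {0..<m} Q"
  proof (rule mono_onI)
    fix y z assume "y \<in> {0..<m}" "z \<in> {0..<m}" "y \<le> z"
    then show "Q y \<le> Q z"
      unfolding Q_def using R_ne[of z] R_bdd by (intro cInf_superset_mono) (auto simp: R_def)
  qed
  then have Q_meas: "Q \<in> borel_measurable ?L"
    using borel_measurable_mono_on_fnc[of "{0..<m}" Q]
    by (simp add: measurable_cong_sets[OF sets_restrict_space_cong[OF sets_lborel] refl])
  have X_meas: "(\<lambda>y. q (Q y)) \<in> measurable ?L (restrict_space borel S1)"
    using measurable_compose[OF Q_meas borel_measurable_continuous_onI[OF continuous_on_q]]
    by (intro measurable_restrict_space2) auto
  define P where "P = distr ?L (restrict_space borel S1) (\<lambda>y. q (Q y))"
  have "emeasure lborel {0..<m} \<noteq> top"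
    by (cases "0 \<le> m") auto
  then have "finite_measure ?L"
    by (intro finite_measureI) (simp add: space_restrict_space emeasure_restrict_space)
  then have P: "finite_borel_S1 P"
    unfolding finite_borel_S1_def P_def using X_meas
    by (simp add: finite_measure.finite_measure_distr)
  have "measure P (circ_arc 0 b) = Sup (p ` {0..<b})" if b: "0 < b" "b \<le> 2 * pi" for b
  proof -
    have le_m: "Sup (p ` {0..<b}) \<le> m"
      unfolding m_def using b bdd[of "2 * pi"] by (intro cSup_subset_mono) auto
    have ge_0: "0 \<le> Sup (p ` {0..<b})"
      using cSup_upper[OF _ bdd[OF b(2)], of "p 0"] nonneg[of 0] b by force
    have "(\<lambda>y. q (Q y)) -` circ_arc 0 b \<inter> {0..<m} = {0..<Sup (p ` {0..<b})}"
    proof (intro set_eqI)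
      fix y
      have "q (Q y) \<in> circ_arc 0 b \<longleftrightarrow> Q y < b" if y: "y < m"
      proof
        assume "q (Q y) \<in> circ_arc 0 b"
        then obtain s where s: "q (Q y) = q s" "0 \<le> s" "s < b"
          by (auto simp: circ_arc_def)
        then have "Q y = s"
          using Q_range[OF y] b by (intro q_eq_imp_eq) auto
        then show "Q y < b" using s by simp
      next
        assume "Q y < b"
        then show "q (Q y) \<in> circ_arc 0 b"
          using Q_range[OF y] by (auto simp: circ_arc_def)
      qed
      then show "y \<in> (\<lambda>y. q (Q y)) -` circ_arc 0 b \<inter> {0..<m} \<longleftrightarrow> y \<in> {0..<Sup (p ` {0..<b})}"
        using Q_less[of y b] b le_m by auto
    qed
    then have "measure P (circ_arc 0 b) = measure ?L {0..<Sup (p ` {0..<b})}"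
      unfolding P_def using X_meas by (simp add: measure_distr space_restrict_space)
    also have "\<dots> = measure lborel {0..<Sup (p ` {0..<b})}"
      using le_m by (intro measure_restrict_space) auto
    finally show ?thesis
      using ge_0 by simp
  qed
  then show ?thesis
    using that P by blast
qed

section \<open>Measures with prescribed odd part\<close>

text \<open>
  Let \<open>P\<close> and \<open>N\<close> be the measures of the two monotone parts of \<open>h\<close>. On arcs, \<open>P - N\<close> is the increment
  of \<open>h\<close>, because \<open>h\<close> is left-continuous, and therefore odd, because \<open>h\<close> is antiperiodic. Thus
  \<open>\<mu> = (P + N\<^sup>-) / 4\<close> satisfies \<open>\<mu> - \<mu>\<^sup>- = ((P - N) - (P - N)\<^sup>-) / 4 = (P - N) / 2\<close>.
  Left limits can lose mass at \<open>2\<pi>\<close>, so the total mass is bounded only from above.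
\<close>
lemma measure_with_prescribed_odd_part:
  fixes h :: "real \<Rightarrow> real"
  assumes bound: "\<And>v. v \<in> variation_sums h (2 * pi) \<Longrightarrow> v \<le> T"
    and anti: "\<And>t. h (t + pi) = - h t"
    and left_cont: "\<And>b L. (h \<longlongrightarrow> L) (at_left b) \<Longrightarrow> h b = L"
  shows "\<exists>\<mu>. finite_borel_S1 \<mu> \<and> measure \<mu> S1 \<le> T / 4 \<and> (\<forall>b\<in>{0..pi}.
      2 * (measure \<mu> (circ_arc 0 b) - measure \<mu> (uminus ` circ_arc 0 b)) = h b - h 0)"
proof -
  obtain p n where p: "mono_on {0..2 * pi} p" "\<And>t. t \<in> {0..2 * pi} \<Longrightarrow> 0 \<le> p t"
    and n: "mono_on {0..2 * pi} n" "\<And>t. t \<in> {0..2 * pi} \<Longrightarrow> 0 \<le> n t"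
    and T: "\<And>t. t \<in> {0..2 * pi} \<Longrightarrow> p t + n t \<le> T" and h: "\<And>t. h t = h 0 + p t - n t"
    using jordan_decomposition[OF bound] by metis
  obtain P where P: "finite_borel_S1 P"
    "\<And>b. 0 < b \<Longrightarrow> b \<le> 2 * pi \<Longrightarrow> measure P (circ_arc 0 b) = Sup (p ` {0..<b})"
    using measure_of_mono_on[OF p] by blast
  obtain N where N: "finite_borel_S1 N"
    "\<And>b. 0 < b \<Longrightarrow> b \<le> 2 * pi \<Longrightarrow> measure N (circ_arc 0 b) = Sup (n ` {0..<b})"
    using measure_of_mono_on[OF n] by blast
  have limP: "(p \<longlongrightarrow> measure P (circ_arc 0 b)) (at_left b)" if "0 < b" "b \<le> 2 * pi" for b
    using mono_on_tendsto_left[OF p(1) that] P(2) that by simp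
  have limN: "(n \<longlongrightarrow> measure N (circ_arc 0 b)) (at_left b)" if "0 < b" "b \<le> 2 * pi" for b
    using mono_on_tendsto_left[OF n(1) that] N(2) that by simp
  have diff: "measure P (circ_arc 0 b) - measure N (circ_arc 0 b) = h b - h 0" if "0 \<le> b" "b \<le> 2 * pi" for b
  proof (cases "b = 0")
    case False
    then have b: "0 < b" using that by simp
    have "((\<lambda>t. h 0 + p t - n t) \<longlongrightarrow> h 0 + measure P (circ_arc 0 b) - measure N (circ_arc 0 b)) (at_left b)"
      using limP[OF b that(2)] limN[OF b that(2)] by (intro tendsto_intros)
    then have "(h \<longlongrightarrow> h 0 + measure P (circ_arc 0 b) - measure N (circ_arc 0 b)) (at_left b)"
      unfolding h[symmetric] .
    from left_cont[OF this] show ?thesis by simp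
  qed (simp add: circ_arc_def)
  have mass: "measure P S1 + measure N S1 \<le> T"
  proof (rule tendsto_upperbound)
    show "((\<lambda>t. p t + n t) \<longlongrightarrow> measure P S1 + measure N S1) (at_left (2 * pi))"
      using tendsto_add[OF limP[of "2 * pi"] limN[of "2 * pi"]] by (simp add: circ_arc_full')
    show "eventually (\<lambda>t. p t + n t \<le> T) (at_left (2 * pi))"
      by (rule eventually_at_leftI[of 0]) (auto intro: T)
  qed simp
  have "\<exists>\<mu>. finite_borel_S1 \<mu> \<and> (\<forall>A\<in>borel_S1. measure \<mu> A = (measure P A + measure N (uminus ` A)) / 4)"
    using finite_borel_S1_sums[OF P(1)] finite_borel_S1_sums[OF N(1)]
    by (intro finite_borel_S1_exists sums_divide sums_add) auto
  then obtain \<mu> where \<mu>: "finite_borel_S1 \<mu>"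
    "\<And>A. A \<in> borel_S1 \<Longrightarrow> measure \<mu> A = (measure P A + measure N (uminus ` A)) / 4"
    by blast
  have "measure \<mu> S1 \<le> T / 4"
    using mass by (simp add: \<mu>(2) uminus_S1)
  moreover have "2 * (measure \<mu> (circ_arc 0 b) - measure \<mu> (uminus ` circ_arc 0 b)) = h b - h 0"
    if b: "0 \<le> b" "b \<le> pi" for b
  proof -
    have opp: "uminus ` circ_arc 0 b = circ_arc pi (b + pi)"
      using uminus_circ_arc[of 0 b] by simp
    have "measure P (circ_arc 0 (b + pi)) = measure P (circ_arc 0 pi) + measure P (circ_arc pi (b + pi))"
      "measure N (circ_arc 0 (b + pi)) = measure N (circ_arc 0 pi) + measure N (circ_arc pi (b + pi))"
      using b circ_arc_measure_Un[OF P(1), of 0 pi "b + pi"] circ_arc_measure_Un[OF N(1), of 0 pi "b + pi"] by auto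
    then have "measure P (circ_arc pi (b + pi)) - measure N (circ_arc pi (b + pi)) = h (b + pi) - h pi"
      using diff[of "b + pi"] diff[of pi] b by simp
    also have "\<dots> = h 0 - h b"
      using anti[of b] anti[of 0] by simp
    finally have "measure P (uminus ` circ_arc 0 b) - measure N (uminus ` circ_arc 0 b) = h 0 - h b"
      by (simp add: opp)
    moreover have "uminus ` (uminus ` circ_arc 0 b) = circ_arc 0 b"
      by (simp add: image_image)
    ultimately show ?thesis
      using diff[of b] b uminus_borel_S1[OF circ_arc_borel, of 0 b] by (simp add: \<mu>(2) field_simps)
  qed
  ultimately show ?thesis
    using \<mu>(1) by auto
qed

section \<open>Representing functions by measures\<close>

lemma left_deriv_has_derivative:
  assumes "left_differentiable f"
  shows "((\<lambda>t. f (q t)) has_real_derivative left_deriv f (q a)) (at_left a)"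
  using left_deriv_tendsto[OF assms] by (simp add: left_derivative_iff)

lemma lipschitz_S1_continuous:
  assumes "lipschitz_S1 f"
  shows "continuous_on UNIV (\<lambda>t. f (q t))"
proof -
  obtain L where L: "\<And>x y. x \<in> S1 \<Longrightarrow> y \<in> S1 \<Longrightarrow> \<bar>f x - f y\<bar> \<le> L * dS1 x y"
    using assms unfolding lipschitz_S1_def by blast
  have "\<bar>f (q s) - f (q t)\<bar> \<le> \<bar>L\<bar> * \<bar>s - t\<bar>" for s t
  proof -
    have "\<bar>f (q s) - f (q t)\<bar> \<le> L * dS1 (q s) (q t)"
      by (rule L) auto
    also have "\<dots> \<le> \<bar>L\<bar> * dS1 (q s) (q t)"
      using dS1_bounds(1)[of "q s" "q t"] by (intro mult_right_mono) auto
    also have "\<dots> \<le> \<bar>L\<bar> * \<bar>s - t\<bar>"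
      using dS1_q_le[of s t] by (intro mult_left_mono) auto
    finally show ?thesis .
  qed
  then have "\<bar>L\<bar>-lipschitz_on UNIV (\<lambda>t. f (q t))"
    by (intro lipschitz_onI) (auto simp: dist_real_def)
  then show ?thesis
    by (rule lipschitz_on_continuous_on)
qed

text \<open>
  Differentiate \<open>f (q (a + \<pi>)) = c - f (q a)\<close>.
\<close>
lemma left_deriv_antipode:
  assumes "left_differentiable f" "\<And>x. x \<in> S1 \<Longrightarrow> f x + f (- x) = c"
  shows "left_deriv f (- q a) = - left_deriv f (q a)"
proof -
  have "(f (q (a + pi + t)) - f (q (a + pi))) / t = - ((f (q (a + t)) - f (q a)) / t)" for t
  proof -
    have "q (a + pi + t) = - q (a + t)"
      using q_plus_pi[of "a + t"] by (simp add: algebra_simps)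
    then have "f (q (a + pi + t)) - f (q (a + pi)) = - (f (q (a + t)) - f (q a))"
      using assms(2)[of "q a"] assms(2)[of "q (a + t)"] q_plus_pi[of a] by simp
    then show ?thesis by (simp only: minus_divide_left)
  qed
  then have "((\<lambda>t. (f (q (a + pi + t)) - f (q (a + pi))) / t) \<longlongrightarrow> - left_deriv f (q a)) (at_left 0)"
    using tendsto_minus[OF left_deriv_tendsto[OF assms(1)]] by simp
  then show ?thesis
    using left_derivI[of f "a + pi"] by (simp add: q_plus_pi)
qed

lemma variation_sums_le_tv_S1:
  assumes "tv_S1 g < \<infinity>" "v \<in> variation_sums (\<lambda>t. g (q t)) (2 * pi)"
  shows "v \<le> enn2real (tv_S1 g)"
proof -
  obtain n x where x: "v = (\<Sum>i=0..n. \<bar>g (q (x i)) - g (q (x (Suc i)))\<bar>)"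
    "x 0 = 0" "x (Suc n) = 2 * pi" "\<forall>i\<le>n. x i \<le> x (Suc i)"
    using assms(2) by (auto simp: variation_sums_def)
  have "ennreal v \<le> tv_S1 g"
    unfolding tv_S1_def x(1) using x(2-) by (intro SUP_upper2[of "(n, x)"]) auto
  then have "enn2real (ennreal v) \<le> enn2real (tv_S1 g)"
    using assms(1) by (intro enn2real_mono) auto
  moreover have "0 \<le> v"
    unfolding x(1) by (intro sum_nonneg) auto
  ultimately show ?thesis by simp
qed

text \<open>
  At \<open>b = \<pi>\<close> both left derivatives change sign, so equal increments on a half circle force equal
  values. Then \<open>f - g\<close> is constant, and it is odd, so it vanishes.
\<close>
lemma eq_if_left_deriv_eq:
  assumes f: "lipschitz_S1 f" "left_differentiable f" "\<And>x. x \<in> S1 \<Longrightarrow> f x + f (- x) = c"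
    and g: "lipschitz_S1 g" "left_differentiable g" "\<And>x. x \<in> S1 \<Longrightarrow> g x + g (- x) = c"
    and inc: "\<And>b. 0 \<le> b \<Longrightarrow> b \<le> pi \<Longrightarrow>
      left_deriv f (q b) - left_deriv f (q 0) = left_deriv g (q b) - left_deriv g (q 0)"
    and x: "x \<in> S1"
  shows "f x = g x"
proof -
  have anti_f: "left_deriv f (- q a) = - left_deriv f (q a)" and
    anti_g: "left_deriv g (- q a) = - left_deriv g (q a)" for a
    using left_deriv_antipode f(2,3) g(2,3) by blast+
  have q_pi: "q pi = - q 0"
    using q_plus_pi[of 0] by simp
  have "left_deriv f (q 0) = left_deriv g (q 0)"
    using inc[of pi] anti_f[of 0] anti_g[of 0] unfolding q_pi by simp
  then have half: "left_deriv f (q b) = left_deriv g (q b)" if "0 \<le> b" "b \<le> pi" for b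
    using inc[OF that] by simp
  have deriv_eq: "left_deriv f (q a) = left_deriv g (q a)" for a
  proof -
    obtain t where t: "q a = q t" "0 \<le> t" "t < 0 + 2 * pi"
      using S1_lift[OF q_in_S1] by metis
    show ?thesis
    proof (cases "t \<le> pi")
      case True
      then show ?thesis using half t by simp
    next
      case False
      then have "q a = - q (t - pi)"
        using t(1) q_plus_pi[of "t - pi"] by simp
      then show ?thesis
        using half[of "t - pi"] False t anti_f[of "t - pi"] anti_g[of "t - pi"] by simp
    qed
  qed
  have const: "f (q a) - g (q a) = f (q b) - g (q b)" for a b
  proof (rule left_derivative_zero_imp_constant[of "\<lambda>t. f (q t) - g (q t)"])
    show "continuous_on UNIV (\<lambda>t. f (q t) - g (q t))"
      using lipschitz_S1_continuous f(1) g(1) by (intro continuous_on_diff)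
    show "((\<lambda>t. f (q t) - g (q t)) has_real_derivative 0) (at_left t)" for t
      using DERIV_diff[OF left_deriv_has_derivative[OF f(2), of t] left_deriv_has_derivative[OF g(2), of t]]
      by (simp add: deriv_eq)
  qed
  obtain a where a: "x = q a"
    using S1_lift[OF x] by metis
  show ?thesis
    using const[of a "a + pi"] f(3)[OF x] g(3)[OF x] unfolding a q_plus_pi by simp
qed

lemma shift_by_H1_exists:
  assumes \<mu>: "finite_borel_S1 \<mu>" and c: "0 \<le> c"
  shows "\<exists>\<mu>'. is_shift_by_H1 \<mu>' \<mu> c"
proof -
  have "\<exists>\<mu>'. finite_borel_S1 \<mu>' \<and> (\<forall>A\<in>borel_S1. measure \<mu>' A = measure \<mu> A + c * measure normalized_H1 A)"
    using finite_borel_S1_sums(1)[OF \<mu>] finite_borel_S1_sums(1)[OF normalized_H1_measure(1)] c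
    by (intro finite_borel_S1_exists sums_add sums_mult) auto
  then show ?thesis
    by (simp add: is_shift_by_H1_def)
qed

lemma shift_by_H1_odd_part:
  assumes "is_shift_by_H1 \<mu>' \<mu> c" "A \<in> borel_S1"
  shows "measure \<mu>' A - measure \<mu>' (uminus ` A) = measure \<mu> A - measure \<mu> (uminus ` A)"
  using assms uminus_borel_S1 by (simp add: is_shift_by_H1_def normalized_H1_uminus)

text \<open>
  The measure with the odd part prescribed by \<open>\<partial>\<^sub>- f\<close> has at most the desired mass, and at most \<open>C\<close>.
  It is filled up to mass \<open>C\<close>; only after the result is known to represent \<open>f\<close> does \<open>represents_tv_le\<close>
  show that its mass was the desired one.
\<close>
lemma exists_minimal_representation:
  assumes sym: "\<And>x. x \<in> S1 \<Longrightarrow> f x + f (- x) = pi * C"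
    and f: "lipschitz_S1 f" "left_differentiable f"
    and tv: "tv_S1 (left_deriv f) < \<infinity>" "tv_S1 (left_deriv f) \<le> ennreal (4 * C)" and C: "0 \<le> C"
  obtains \<mu> \<mu>' where "finite_borel_S1 \<mu>" "measure \<mu> S1 = 1/4 * enn2real (tv_S1 (left_deriv f))"
    "is_shift_by_H1 \<mu>' \<mu> (C - 1/4 * enn2real (tv_S1 (left_deriv f)))" "represents \<mu>' f" "measure \<mu>' S1 = C"
proof -
  define T where "T = enn2real (tv_S1 (left_deriv f))"
  define h where "h t = left_deriv f (q t)" for t
  have T: "T \<le> 4 * C"
    using enn2real_mono[OF tv(2)] C by (simp add: T_def)
  have "\<exists>\<mu>. finite_borel_S1 \<mu> \<and> measure \<mu> S1 \<le> T / 4 \<and> (\<forall>b\<in>{0..pi}.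
      2 * (measure \<mu> (circ_arc 0 b) - measure \<mu> (uminus ` circ_arc 0 b)) = h b - h 0)"
  proof (rule measure_with_prescribed_odd_part[of h T])
    show "v \<le> T" if "v \<in> variation_sums h (2 * pi)" for v
      using variation_sums_le_tv_S1[OF tv(1)] that unfolding T_def h_def[abs_def] by blast
    show "h (t + pi) = - h t" for t
      using left_deriv_antipode[OF f(2) sym] by (simp add: h_def q_plus_pi)
    show "h b = L" if "(h \<longlongrightarrow> L) (at_left b)" for b L
      using that left_deriv_has_derivative[OF f(2)] unfolding h_def[symmetric]
      by (intro left_derivative_left_continuous[OF lipschitz_S1_continuous[OF f(1)]])
  qed
  then obtain \<mu> where \<mu>: "finite_borel_S1 \<mu>" "measure \<mu> S1 \<le> T / 4"
    "\<And>b. 0 \<le> b \<Longrightarrow> b \<le> pi \<Longrightarrow>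
      2 * (measure \<mu> (circ_arc 0 b) - measure \<mu> (uminus ` circ_arc 0 b)) = h b - h 0"
    by auto
  obtain \<mu>' where \<mu>': "is_shift_by_H1 \<mu>' \<mu> (C - measure \<mu> S1)"
    using shift_by_H1_exists[OF \<mu>(1), of "C - measure \<mu> S1"] \<mu>(2) T by auto
  have fin': "finite_borel_S1 \<mu>'"
    using \<mu>' by (simp add: is_shift_by_H1_def)
  have mass': "measure \<mu>' S1 = C"
    using \<mu>' by (simp add: is_shift_by_H1_def normalized_H1_S1)
  define g where "g x = (\<integral>y. dS1 x y \<partial>\<mu>')" for x
  have g: "represents \<mu>' g"
    by (simp add: represents_def g_def)
  have "f x = g x" if "x \<in> S1" for x
  proof (rule eq_if_left_deriv_eq[OF f sym _ _ _ _ that])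
    show "lipschitz_S1 g" "left_differentiable g"
      using represents_lipschitz[OF fin' g] represents_left_differentiable[OF fin' g] by auto
    show "x \<in> S1 \<Longrightarrow> g x + g (- x) = pi * C" for x
      using represents_antipode_sum[OF fin' g] mass' by simp
    show "left_deriv f (q b) - left_deriv f (q 0) = left_deriv g (q b) - left_deriv g (q 0)"
      if b: "0 \<le> b" "b \<le> pi" for b
      using represents_left_deriv_increment[OF fin' g b(1)] b \<mu>(3)[OF b]
        shift_by_H1_odd_part[OF \<mu>' circ_arc_borel, of 0 b] by (simp add: h_def)
  qed
  then have rep: "represents \<mu>' f"
    using g by (simp add: represents_def)
  have "tv_S1 (left_deriv f) \<le> ennreal (4 * measure \<mu> S1)"
    using shift_by_H1_odd_part[OF \<mu>'] by (intro represents_tv_le[OF fin' rep \<mu>(1)]) simp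
  then have "T \<le> 4 * measure \<mu> S1"
    using enn2real_mono[of "tv_S1 (left_deriv f)" "ennreal (4 * measure \<mu> S1)"] by (simp add: T_def)
  then have mass: "measure \<mu> S1 = 1/4 * enn2real (tv_S1 (left_deriv f))"
    using \<mu>(2) by (simp add: T_def)
  show ?thesis
    by (rule that[OF \<mu>(1) mass \<mu>'[unfolded mass] rep mass'])
qed

section \<open>Uniqueness of the minimal measure\<close>

text \<open>
  Let \<open>Y\<close> be a Hahn set of the signed measure \<open>d = \<mu> - \<mu>'\<close>, and let \<open>\<kappa>\<close> be \<open>\<mu>\<close> off \<open>Y\<close> and \<open>\<mu>'\<close> on
  \<open>Y\<close>. As \<open>d\<close> is antipodally symmetric, so is its positive part, which makes the odd part of \<open>\<kappa>\<close> that of \<open>\<mu>\<close>.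
  Minimality of the mass gives \<open>d Y \<le> 0\<close>, and \<open>d\<close> has total mass \<open>0\<close>, so \<open>d\<close> vanishes.
\<close>
lemma minimal_measure_unique:
  assumes \<nu>: "finite_borel_S1 \<nu>" "represents \<nu> f"
    and \<mu>: "finite_borel_S1 \<mu>" "4 * measure \<mu> S1 = enn2real (tv_S1 (left_deriv f))"
    and \<mu>': "finite_borel_S1 \<mu>'" "4 * measure \<mu>' S1 = enn2real (tv_S1 (left_deriv f))"
    and odd: "\<And>A. A \<in> borel_S1 \<Longrightarrow> measure \<mu> A - measure \<mu> (uminus ` A) = measure \<nu> A - measure \<nu> (uminus ` A)"
    and odd': "\<And>A. A \<in> borel_S1 \<Longrightarrow> measure \<mu>' A - measure \<mu>' (uminus ` A) = measure \<nu> A - measure \<nu> (uminus ` A)"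
  shows "\<mu> = \<mu>'"
proof -
  interpret M: finite_measure \<mu>
    using \<mu>(1) by (rule finite_borel_S1D)
  interpret N: finite_measure \<mu>'
    using \<mu>'(1) by (rule finite_borel_S1D)
  have sets: "sets \<mu> = borel_S1" "sets \<mu>' = borel_S1"
    using \<mu>(1) \<mu>'(1) finite_borel_S1D by auto
  define d where "d A = measure \<mu> A - measure \<mu>' A" for A
  have d_uminus: "d (uminus ` A) = d A" if "A \<in> borel_S1" for A
    using odd[OF that] odd'[OF that] by (simp add: d_def)
  have d_Un: "d (A \<union> B) = d A + d B" if "A \<in> borel_S1" "B \<in> borel_S1" "A \<inter> B = {}" for A B
    using that M.finite_measure_Union[of A B] N.finite_measure_Union[of A B] by (simp add: d_def sets)
  obtain Y where Y: "Y \<in> borel_S1" "\<And>X. X \<in> borel_S1 \<Longrightarrow> X \<subseteq> Y \<Longrightarrow> 0 \<le> d X"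
    "\<And>X. X \<in> borel_S1 \<Longrightarrow> X \<inter> Y = {} \<Longrightarrow> d X \<le> 0"
  proof -
    obtain Y where "Y \<in> sets \<mu>" "\<forall>X\<in>sets \<mu>. X \<subseteq> Y \<longrightarrow> emeasure \<mu>' X \<le> emeasure \<mu> X"
      "\<forall>X\<in>sets \<mu>. X \<inter> Y = {} \<longrightarrow> emeasure \<mu> X \<le> emeasure \<mu>' X"
      using finite_unsigned_Hahn_decomposition[OF M.finite_measure_axioms N.finite_measure_axioms] sets by auto
    then show ?thesis
      using that[of Y] by (simp add: sets d_def M.emeasure_eq_measure N.emeasure_eq_measure)
  qed
  have d_Int_uminus: "d (uminus ` A \<inter> Y) = d (A \<inter> Y)" if A: "A \<in> borel_S1" for A
  proof -
    \<comment> \<open>This set lies in the positive part, while its antipode lies in the negative one.\<close>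
    have null: "d (B \<inter> Y - uminus ` Y) = 0" if B: "B \<in> borel_S1" for B
    proof (rule antisym)
      let ?Z = "B \<inter> Y - uminus ` Y"
      have Z: "?Z \<in> borel_S1"
        using B Y(1) uminus_borel_S1[OF Y(1)] by (intro sets.Diff sets.Int) auto
      show "0 \<le> d ?Z"
        using Z by (intro Y(2)) auto
      have "d (uminus ` ?Z) \<le> 0"
      proof (rule Y(3))
        show "uminus ` ?Z \<in> borel_S1"
          using Z by (rule uminus_borel_S1)
        show "uminus ` ?Z \<inter> Y = {}"
          by (force simp: image_iff)
      qed
      then show "d ?Z \<le> 0"
        using d_uminus[OF Z] by simp
    qed
    have split: "d (B \<inter> Y) = d (B \<inter> Y \<inter> uminus ` Y)" if B: "B \<in> borel_S1" for B
    proof -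
      have "d (B \<inter> Y) = d ((B \<inter> Y \<inter> uminus ` Y) \<union> (B \<inter> Y - uminus ` Y))"
        by (rule arg_cong[of _ _ d]) auto
      also have "\<dots> = d (B \<inter> Y \<inter> uminus ` Y) + d (B \<inter> Y - uminus ` Y)"
        using B Y(1) uminus_borel_S1[OF Y(1)] by (intro d_Un sets.Diff sets.Int) auto
      finally show ?thesis
        using null[OF B] by simp
    qed
    have "uminus ` (A \<inter> Y \<inter> uminus ` Y) = uminus ` A \<inter> Y \<inter> uminus ` Y"
      by (force simp: image_iff)
    moreover have "A \<inter> Y \<inter> uminus ` Y \<in> borel_S1"
      using A Y(1) uminus_borel_S1[OF Y(1)] by (intro sets.Int) auto
    ultimately have "d (uminus ` A \<inter> Y \<inter> uminus ` Y) = d (A \<inter> Y \<inter> uminus ` Y)"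
      using d_uminus by metis
    then show ?thesis
      using split[OF A] split[OF uminus_borel_S1[OF A]] by simp
  qed
  have "\<exists>\<kappa>. finite_borel_S1 \<kappa> \<and> (\<forall>A\<in>borel_S1. measure \<kappa> A = measure \<mu> (A - Y) + measure \<mu>' (A \<inter> Y))"
  proof (rule finite_borel_S1_exists)
    fix A :: "nat \<Rightarrow> (real^2) set"
    assume A: "range A \<subseteq> borel_S1" "disjoint_family A"
    have "disjoint_family (\<lambda>i. A i - Y)" "disjoint_family (\<lambda>i. A i \<inter> Y)"
      using A(2) by (auto simp: disjoint_family_on_def)
    moreover have "range (\<lambda>i. A i - Y) \<subseteq> borel_S1" "range (\<lambda>i. A i \<inter> Y) \<subseteq> borel_S1"
      using A(1) Y(1) by auto
    ultimately have "(\<lambda>i. measure \<mu> (A i - Y)) sums measure \<mu> (\<Union>i. A i - Y)"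
      "(\<lambda>i. measure \<mu>' (A i \<inter> Y)) sums measure \<mu>' (\<Union>i. A i \<inter> Y)"
      using finite_borel_S1_sums(1)[OF \<mu>(1)] finite_borel_S1_sums(1)[OF \<mu>'(1)] by blast+
    then show "(\<lambda>i. measure \<mu> (A i - Y) + measure \<mu>' (A i \<inter> Y)) sums (measure \<mu> ((\<Union>i. A i) - Y) + measure \<mu>' ((\<Union>i. A i) \<inter> Y))"
      unfolding UN_extend_simps by (intro sums_add) auto
  qed simp
  then obtain \<kappa> where \<kappa>: "finite_borel_S1 \<kappa>"
    "\<And>A. A \<in> borel_S1 \<Longrightarrow> measure \<kappa> A = measure \<mu> (A - Y) + measure \<mu>' (A \<inter> Y)"
    by blast
  have \<kappa>_eq: "measure \<kappa> A = measure \<mu> A - d (A \<inter> Y)" if A: "A \<in> borel_S1" for A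
  proof -
    have "measure \<mu> ((A - Y) \<union> (A \<inter> Y)) = measure \<mu> (A - Y) + measure \<mu> (A \<inter> Y)"
      using A Y(1) by (intro M.finite_measure_Union) (auto simp: sets)
    moreover have "(A - Y) \<union> (A \<inter> Y) = A" by auto
    ultimately show ?thesis
      by (simp add: \<kappa>(2)[OF A] d_def)
  qed
  have "tv_S1 (left_deriv f) \<le> ennreal (4 * measure \<kappa> S1)"
  proof (rule represents_tv_le[OF \<nu> \<kappa>(1)])
    fix A assume A: "A \<in> borel_S1"
    then show "measure \<kappa> A - measure \<kappa> (uminus ` A) = measure \<nu> A - measure \<nu> (uminus ` A)"
      using odd[OF A] d_Int_uminus[OF A] by (simp add: \<kappa>_eq uminus_borel_S1)
  qed
  then have "enn2real (tv_S1 (left_deriv f)) \<le> 4 * measure \<kappa> S1"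
    using enn2real_mono[of "tv_S1 (left_deriv f)" "ennreal (4 * measure \<kappa> S1)"] by simp
  moreover have "S1 \<inter> Y = Y"
    using Y(1) by (auto simp: borel_S1_iff)
  ultimately have "d Y \<le> 0"
    using \<mu>(2) \<kappa>_eq[of S1] by simp
  then have dY: "d Y = 0"
    using Y(2)[OF Y(1)] by simp
  have "d (Y \<union> (S1 - Y)) = d Y + d (S1 - Y)"
    using Y(1) by (intro d_Un) auto
  moreover have "Y \<union> (S1 - Y) = S1"
    using Y(1) by (auto simp: borel_S1_iff)
  moreover have "d S1 = 0"
    using \<mu>(2) \<mu>'(2) by (simp add: d_def)
  ultimately have dYc: "d (S1 - Y) = 0"
    using dY by simp
  have d_zero: "d A = 0" if A: "A \<in> borel_S1" for A
  proof -
    have "d ((A \<inter> Y) \<union> (Y - A)) = d (A \<inter> Y) + d (Y - A)"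
      using A Y(1) by (intro d_Un) auto
    moreover have "(A \<inter> Y) \<union> (Y - A) = Y" by auto
    moreover have "0 \<le> d (A \<inter> Y)" "0 \<le> d (Y - A)"
      using A Y(1) by (auto intro!: Y(2))
    ultimately have 1: "d (A \<inter> Y) = 0"
      using dY by simp
    have "d ((A - Y) \<union> (S1 - Y - A)) = d (A - Y) + d (S1 - Y - A)"
      using A Y(1) by (intro d_Un sets.Diff) auto
    moreover have "(A - Y) \<union> (S1 - Y - A) = S1 - Y"
      using A by (auto simp: borel_S1_iff)
    moreover have "d (A - Y) \<le> 0" "d (S1 - Y - A) \<le> 0"
      using A Y(1) by (auto intro!: Y(3) sets.Diff)
    ultimately have 2: "d (A - Y) = 0"
      using dYc by simp
    have "d ((A \<inter> Y) \<union> (A - Y)) = d (A \<inter> Y) + d (A - Y)"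
      using A Y(1) by (intro d_Un) auto
    moreover have "(A \<inter> Y) \<union> (A - Y) = A" by auto
    ultimately show ?thesis
      using 1 2 by simp
  qed
  show ?thesis
  proof (rule measure_eqI)
    show "sets \<mu> = sets \<mu>'"
      by (simp add: sets)
    fix A assume "A \<in> sets \<mu>"
    then show "emeasure \<mu> A = emeasure \<mu>' A"
      using d_zero[of A] by (simp add: sets d_def M.emeasure_eq_measure N.emeasure_eq_measure)
  qed
qed

section \<open>Characterisation of representable functions\<close>

theorem corollary1p5:
  fixes f :: "real^2 \<Rightarrow> real" and C :: real
  assumes "C \<ge> 0"
  shows "((\<exists>\<nu>. finite_borel_S1 \<nu> \<and> measure \<nu> S1 = C \<and> represents \<nu> f) \<longleftrightarrow>
            (\<forall>x\<in>S1. f x + f (- x) = pi * C) \<and>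
            lipschitz_S1 f \<and> left_differentiable f \<and>
            tv_S1 (left_deriv f) < \<infinity> \<and>
            tv_S1 (left_deriv f) \<le> ennreal (4 * C))
       \<and> ((\<exists>\<nu>. finite_borel_S1 \<nu> \<and> measure \<nu> S1 = C \<and> represents \<nu> f) \<longrightarrow>
            (\<exists>!\<mu>. finite_borel_S1 \<mu> \<and>
                  measure \<mu> S1 = 1/4 * enn2real (tv_S1 (left_deriv f)) \<and>
                  (\<exists>\<mu>'. is_shift_by_H1 \<mu>' \<mu> (C - 1/4 * enn2real (tv_S1 (left_deriv f))) \<and>
                        represents \<mu>' f)))"
    (is "(?rep \<longleftrightarrow> ?char) \<and> (?rep \<longrightarrow> ?unique)")
proof (rule conjI; (rule iffI | rule impI))
  assume ?rep
  then obtain \<nu> where \<nu>: "finite_borel_S1 \<nu>" "measure \<nu> S1 = C" "represents \<nu> f"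
    by blast
  have tv: "tv_S1 (left_deriv f) \<le> ennreal (4 * C)"
    using represents_tv_le[OF \<nu>(1,3,1)] \<nu>(2) by simp
  then have "tv_S1 (left_deriv f) < \<infinity>"
    by (rule order.strict_trans1) simp
  then show ?char
    using represents_antipode_sum[OF \<nu>(1,3)] \<nu>(2) tv represents_lipschitz[OF \<nu>(1,3)]
      represents_left_differentiable[OF \<nu>(1,3)] by simp
next
  assume char: ?char
  obtain \<mu> \<mu>' where "finite_borel_S1 \<mu>" "is_shift_by_H1 \<mu>' \<mu> (C - 1/4 * enn2real (tv_S1 (left_deriv f)))"
    "represents \<mu>' f" "measure \<mu>' S1 = C"
    using exists_minimal_representation[of f C] char assms by blast
  then show ?rep
    by (auto simp: is_shift_by_H1_def)
next
  assume ?rep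
  then obtain \<nu> where \<nu>: "finite_borel_S1 \<nu>" "measure \<nu> S1 = C" "represents \<nu> f"
    by blast
  have tv: "tv_S1 (left_deriv f) \<le> ennreal (4 * C)"
    using represents_tv_le[OF \<nu>(1,3,1)] \<nu>(2) by simp
  then have fin: "tv_S1 (left_deriv f) < \<infinity>"
    by (rule order.strict_trans1) simp
  have sym: "\<And>x. x \<in> S1 \<Longrightarrow> f x + f (- x) = pi * C"
    using represents_antipode_sum[OF \<nu>(1,3)] \<nu>(2) by simp
  show ?unique
  proof (rule ex_ex1I)
    show "\<exists>\<mu>. finite_borel_S1 \<mu> \<and> measure \<mu> S1 = 1/4 * enn2real (tv_S1 (left_deriv f)) \<and>
      (\<exists>\<mu>'. is_shift_by_H1 \<mu>' \<mu> (C - 1/4 * enn2real (tv_S1 (left_deriv f))) \<and> represents \<mu>' f)"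
      using exists_minimal_representation[OF sym represents_lipschitz[OF \<nu>(1,3)]
        represents_left_differentiable[OF \<nu>(1,3)] fin tv assms] by blast
  next
    fix \<mu>1 \<mu>2
    assume 1: "finite_borel_S1 \<mu>1 \<and> measure \<mu>1 S1 = 1/4 * enn2real (tv_S1 (left_deriv f)) \<and>
      (\<exists>\<mu>'. is_shift_by_H1 \<mu>' \<mu>1 (C - 1/4 * enn2real (tv_S1 (left_deriv f))) \<and> represents \<mu>' f)"
    assume 2: "finite_borel_S1 \<mu>2 \<and> measure \<mu>2 S1 = 1/4 * enn2real (tv_S1 (left_deriv f)) \<and>
      (\<exists>\<mu>'. is_shift_by_H1 \<mu>' \<mu>2 (C - 1/4 * enn2real (tv_S1 (left_deriv f))) \<and> represents \<mu>' f)"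
    have odd: "measure \<mu> A - measure \<mu> (uminus ` A) = measure \<nu> A - measure \<nu> (uminus ` A)"
      if "is_shift_by_H1 \<mu>' \<mu> c" "represents \<mu>' f" "A \<in> borel_S1" for \<mu> \<mu>' c A
      using shift_by_H1_odd_part[OF that(1,3)] represents_odd_part_unique[OF _ that(2) \<nu>(1,3) that(3)] that(1)
      by (simp add: is_shift_by_H1_def)
    show "\<mu>1 = \<mu>2"
      using 1 2 odd by (intro minimal_measure_unique[OF \<nu>(1,3)]) auto
  qed
qed

end
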